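(* Let $\alpha\in(0,1)$ and let $N>1$ be an integer. Let $X_1,X_2,\dots$ be real-valued observations and define the $t$-statistics $$T_n=\frac{\frac1{\sqrt n}\sum_{i=1}^nX_i}{\sqrt{\frac1{n-1}\sum_{i=1}^n\bigl(X_i-\frac1n\sum_{j=1}^nX_j\bigr)^2}}\quad(n\ge2),$$ and $T_1=-\infty$ if $X_1<0$, $T_1=0$ if $X_1=0$, $T_1=+\infty$ if $X_1>0$. Let $\mathcal{F}_n=\sigma(T_1,\dots,T_n)$ for $n\ge0$ ($\mathcal{F}_0$ trivial). Let $\phi_N=\mathbb{I}\{T_N>c_{\alpha,N}\}$ be the one-sided $t$-test, where $c_{\alpha,N}$ is the $\alpha$ upper-quantile of the $t$-distribution with $N-1$ degrees of freedom, and let the induced sequential $t$-test be $$\phi_n'=\mathbb{E}^{\mathcal{N}(0,1)}[\phi_N\mid\mathcal{F}_n],\qquad n\ge0,$$ where $\mathbb{E}^{\mathcal{N}(0,1)}$ is the expectation when $X_1,X_2,\dots$ are i.i.d. $\mathcal{N}(0,1)$. Then $(\phi_n')$ is anytime valid at level $\alpha$ for the composite hypothesis $$H=\{\mathbb{P}_{\mu,\sigma}=\mathcal{N}(\mu,\sigma^2):\mu\le0,\ \sigma^2>0\},$$ where under $\mathbb{P}_{\mu,\sigma}$ the observations $X_1,X_2,\dots$ are i.i.d. $\mathcal{N}(\mu,\sigma^2)$.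
   Context: Anytime valid at level $\alpha$ for $H$ means: $\sup_{\mathbb{P}\in H}\mathbb{E}^{\mathbb{P}}[\phi'_\tau]\le\alpha$ for every (possibly infinite) stopping time $\tau$ with respect to the filtration $(\mathcal{F}_n)_{n\ge0}$ generated by the $t$-statistics, where $\phi'_\infty:=\limsup_{n\to\infty}\phi'_n$. The $\alpha$ upper-quantile $c$ of a continuous distribution is the value exceeded with probability $\alpha$. *)

theory Defs
  imports "HOL-Probability.Probability"
begin

definition iid_normal :: "'a measure \<Rightarrow> (nat \<Rightarrow> 'a \<Rightarrow> real) \<Rightarrow> real \<Rightarrow> real \<Rightarrow> bool" where
  "iid_normal P X \<mu> \<sigma> \<longleftrightarrow>
     prob_space P \<and>
     prob_space.indep_vars P (\<lambda>_. borel) X {1..} \<and>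
     (\<forall>i\<ge>1. distributed P lborel (X i) (normal_density \<mu> \<sigma>))"

text \<open>The measure \<open>M\<close> only supplies the measurable space. A model \<open>\<P>\<^sub>\<mu>\<^sub>,\<^sub>\<sigma>\<close> is represented by any
  probability measure on it under which the observations have the required joint law;
  \<open>\<sigma>\<close> is the standard deviation.\<close>

definition nonpos_mean_normal :: "'a measure \<Rightarrow> (nat \<Rightarrow> 'a \<Rightarrow> real) \<Rightarrow> 'a measure set" where
  "nonpos_mean_normal M X =
     {P. sets P = sets M \<and> (\<exists>\<mu> \<sigma>. \<mu> \<le> 0 \<and> \<sigma> > 0 \<and> iid_normal P X \<mu> \<sigma>)}"

definition sample_mean :: "(nat \<Rightarrow> 'a \<Rightarrow> real) \<Rightarrow> nat \<Rightarrow> 'a \<Rightarrow> real" where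
  "sample_mean X n \<omega> = (\<Sum>i=1..n. X i \<omega>) / real n"

definition sample_var :: "(nat \<Rightarrow> 'a \<Rightarrow> real) \<Rightarrow> nat \<Rightarrow> 'a \<Rightarrow> real" where
  "sample_var X n \<omega> = (\<Sum>i=1..n. (X i \<omega> - sample_mean X n \<omega>)\<^sup>2) / (real n - 1)"

text \<open>The quotient is taken in the extended reals, where \<open>x / 0\<close> is \<open>-\<infinity>\<close>, \<open>0\<close> or \<open>\<infinity>\<close> according to
  the sign of \<open>x\<close>. So for \<open>n \<ge> 2\<close> the event that the sample variance vanishes (of probability
  zero under every normal model) is treated like the case \<open>n = 1\<close>. The value at \<open>n = 0\<close> is
  never used.\<close>

definition t_stat :: "(nat \<Rightarrow> 'a \<Rightarrow> real) \<Rightarrow> nat \<Rightarrow> 'a \<Rightarrow> ereal" where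
  "t_stat X n \<omega> =
     (if n = 1 then (if X 1 \<omega> < 0 then - \<infinity> else if X 1 \<omega> = 0 then 0 else \<infinity>)
      else ereal ((\<Sum>i=1..n. X i \<omega>) / sqrt (real n)) / ereal (sqrt (sample_var X n \<omega>)))"

text \<open>The filtration is indexed by \<^typ>\<open>enat\<close> so that the library's \<^const>\<open>stopping_time\<close> covers
  stopping times with value \<open>\<infinity>\<close>; its condition at time \<open>\<infinity>\<close> is vacuous.\<close>

definition t_filtration :: "'a measure \<Rightarrow> (nat \<Rightarrow> 'a \<Rightarrow> real) \<Rightarrow> enat \<Rightarrow> 'a measure" where
  "t_filtration M X t =
     sigma (space M)
       {t_stat X k -` A \<inter> space M | k A. 1 \<le> k \<and> enat k \<le> t \<and> A \<in> sets borel}"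

definition student_t_density :: "real \<Rightarrow> real \<Rightarrow> real" where
  "student_t_density \<nu> x =
     Gamma ((\<nu> + 1) / 2) / (sqrt (\<nu> * pi) * Gamma (\<nu> / 2)) *
     (1 + x\<^sup>2 / \<nu>) powr (- (\<nu> + 1) / 2)"

definition student_t :: "real \<Rightarrow> real measure" where
  "student_t \<nu> = density lborel (student_t_density \<nu>)"

definition is_upper_quantile :: "real measure \<Rightarrow> real \<Rightarrow> real \<Rightarrow> bool" where
  "is_upper_quantile D \<alpha> c \<longleftrightarrow> measure D {c<..} = \<alpha>"

definition t_test :: "(nat \<Rightarrow> 'a \<Rightarrow> real) \<Rightarrow> nat \<Rightarrow> real \<Rightarrow> 'a \<Rightarrow> real" where
  "t_test X N c = indicator {\<omega>. t_stat X N \<omega> > ereal c}"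

text \<open>Conditional expectations are determined only almost surely, so \<open>\<phi>'\<close> may consist of arbitrary
  (adapted) versions.\<close>

definition induced_sequential_test ::
    "'a measure \<Rightarrow> (enat \<Rightarrow> 'a measure) \<Rightarrow> ('a \<Rightarrow> real) \<Rightarrow> (nat \<Rightarrow> 'a \<Rightarrow> real) \<Rightarrow> bool" where
  "induced_sequential_test P F \<phi> \<phi>' \<longleftrightarrow>
     (\<forall>n. \<phi>' n \<in> borel_measurable (F (enat n)) \<and>
          (AE \<omega> in P. \<phi>' n \<omega> = real_cond_exp P (F (enat n)) \<phi> \<omega>))"

definition stopped_test :: "(nat \<Rightarrow> 'a \<Rightarrow> real) \<Rightarrow> ('a \<Rightarrow> enat) \<Rightarrow> 'a \<Rightarrow> ereal" where
  "stopped_test \<phi> \<tau> \<omega> =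
     (case \<tau> \<omega> of enat n \<Rightarrow> ereal (\<phi> n \<omega>) | \<infinity> \<Rightarrow> limsup (\<lambda>n. ereal (\<phi> n \<omega>)))"

text \<open>Tests are (almost surely) \<open>[0, 1]\<close>-valued, so the expectation is taken as a nonnegative
  integral. It needs no integrability side condition, and truncating negative values at \<open>0\<close> can
  only increase it.\<close>

definition anytime_valid ::
    "'a measure set \<Rightarrow> (enat \<Rightarrow> 'a measure) \<Rightarrow> (nat \<Rightarrow> 'a \<Rightarrow> real) \<Rightarrow> real \<Rightarrow> bool" where
  "anytime_valid H F \<phi> \<alpha> \<longleftrightarrow>
     (\<forall>\<tau>. stopping_time F \<tau> \<longrightarrow>
        (SUP P\<in>H. \<integral>\<^sup>+\<omega>. e2ennreal (stopped_test \<phi> \<tau> \<omega>) \<partial>P) \<le> ennreal \<alpha>)"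

end

theory Submission
  imports Defs
begin

text \<open>Write \<open>S\<^sub>n\<close> for the sum of the first \<open>n\<close> observations, \<open>Q\<^sub>n\<close> for the sum of their squares and
  \<open>R\<^sub>n = S\<^sub>n / sqrt Q\<^sub>n\<close>. The statistic \<open>T\<^sub>n\<close> is a strictly increasing function of \<open>R\<^sub>n\<close>, so the test
  is \<open>\<phi>\<^sub>N = 1{R\<^sub>N > c'}\<close> and \<open>R\<^sub>n\<close> is adapted. Everything rests on one fact about the reference model
  \<open>N(0,1)\<close>: the filtration only sees events that are invariant under rescaling the sample, and such
  events are independent of \<open>(Q\<^sub>n, X\<^sub>n\<^sub>+\<^sub>1)\<close>. Since
  \<open>R\<^sub>n\<^sub>+\<^sub>1 = (R\<^sub>n * sqrt Q\<^sub>n + X\<^sub>n\<^sub>+\<^sub>1) / sqrt (Q\<^sub>n + X\<^sub>n\<^sub>+\<^sub>1\<^sup>2)\<close>, the process \<open>R\<close> is a Markov chain under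
  \<open>N(0,1)\<close>, and one step of it is increasing in the current state.
  
  This has three consequences. By backward induction from \<open>\<phi>\<^sub>N\<close>, each \<open>\<phi>'\<^sub>n\<close> is almost surely an increasing
  function of \<open>R\<^sub>n\<close> (\<open>induced_test_mono_ratio\<close>). On the \<open>n\<close>-th \<open>\<sigma>\<close>-algebra, \<open>N(\<mu>,\<sigma>\<^sup>2)\<close> has a density
  \<open>L\<^sub>n(R\<^sub>n)\<close> with respect to \<open>N(0,1)\<close>: the average over \<open>Q\<^sub>n\<close> of the Gaussian likelihood ratio
  \<open>exp (\<theta> R\<^sub>n sqrt Q\<^sub>n - n \<theta>\<^sup>2 / 2)\<close>, \<open>\<theta> = \<mu> / \<sigma>\<close> (\<open>nn_integral_F_change_of_measure\<close>). For \<open>\<mu> \<le> 0\<close> it is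
  decreasing in \<open>R\<^sub>n\<close>. Finally, given the past, \<open>\<phi>'\<^sub>n\<^sub>+\<^sub>1\<close> increases and \<open>L\<^sub>n\<^sub>+\<^sub>1\<close> decreases in \<open>R\<^sub>n\<^sub>+\<^sub>1\<close>, so
  by Chebyshev's association inequality they are negatively correlated:
  \<open>E[\<phi>'\<^sub>n\<^sub>+\<^sub>1 L\<^sub>n\<^sub>+\<^sub>1 | F\<^sub>n] \<le> E[\<phi>'\<^sub>n\<^sub>+\<^sub>1 | F\<^sub>n] E[L\<^sub>n\<^sub>+\<^sub>1 | F\<^sub>n] = \<phi>'\<^sub>n L\<^sub>n\<close>. In other words \<open>\<phi>'\<close> is a supermartingale
  under every model of the hypothesis (\<open>ratio_kernel_supermartingale_step\<close>).
  
  From time \<open>N\<close> on the process is constant, so an infinite stopping time costs nothing: the stopped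
  value is at most \<open>E[\<phi>'\<^sub>0]\<close>. As the initial \<open>\<sigma>\<close>-algebra is trivial, this is the level of the fixed-sample
  test under \<open>N(0,1)\<close>, hence \<open>\<alpha>\<close> once \<open>T\<^sub>N\<close> is known to follow Student's law with \<open>N - 1\<close> degrees of freedom
  (\<open>t_test_level\<close>).\<close>

text \<open>The index sets \<open>{1..n}\<close> occur inside product measures; rewriting them to \<open>{Suc 0..n}\<close> would hide the
  lemmas stated for them.\<close>

declare One_nat_def [simp del]

section \<open>Lebesgue and Gaussian product measures\<close>

definition coord_sum :: "nat \<Rightarrow> (nat \<Rightarrow> real) \<Rightarrow> real" where
  "coord_sum n x = (\<Sum>i=1..n. x i)"

definition sumsq :: "nat \<Rightarrow> (nat \<Rightarrow> real) \<Rightarrow> real" where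
  "sumsq n x = (\<Sum>i=1..n. (x i)\<^sup>2)"

abbreviation coords :: "nat \<Rightarrow> (nat \<Rightarrow> real) measure" where
  "coords n \<equiv> \<Pi>\<^sub>M i\<in>{1..n}. borel"

abbreviation leb :: "nat \<Rightarrow> (nat \<Rightarrow> real) measure" where
  "leb n \<equiv> \<Pi>\<^sub>M i\<in>{1..n}. lborel"

abbreviation gauss :: "real \<Rightarrow> real \<Rightarrow> real measure" where
  "gauss \<mu> \<sigma> \<equiv> density lborel (\<lambda>x. ennreal (normal_density \<mu> \<sigma> x))"

abbreviation gauss_prod :: "nat \<Rightarrow> real \<Rightarrow> real \<Rightarrow> (nat \<Rightarrow> real) measure" where
  "gauss_prod n \<mu> \<sigma> \<equiv> \<Pi>\<^sub>M i\<in>{1..n}. gauss \<mu> \<sigma>"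

definition dilate :: "nat \<Rightarrow> real \<Rightarrow> (nat \<Rightarrow> real) \<Rightarrow> nat \<Rightarrow> real" where
  "dilate n a x = (\<lambda>i\<in>{1..n}. a * x i)"

lemma sets_leb: "sets (leb n) = sets (coords n)"
  by (intro sets_PiM_cong) auto

lemma sets_gauss_prod: "sets (gauss_prod n \<mu> \<sigma>) = sets (coords n)"
  by (intro sets_PiM_cong) auto

lemma measurable_leb: "measurable (leb n) N = measurable (coords n) N"
  by (intro measurable_cong_sets sets_leb refl)

lemma measurable_gauss_prod: "measurable (gauss_prod n \<mu> \<sigma>) N = measurable (coords n) N"
  by (intro measurable_cong_sets sets_gauss_prod refl)

lemma coord_sum_measurable [measurable]: "coord_sum n \<in> borel_measurable (coords n)"
  unfolding coord_sum_def by measurable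

lemma sumsq_measurable [measurable]: "sumsq n \<in> borel_measurable (coords n)"
  unfolding sumsq_def by measurable

lemma dilate_measurable [measurable]: "dilate n a \<in> coords n \<rightarrow>\<^sub>M coords n"
  unfolding dilate_def by measurable

lemma sumsq_nonneg: "0 \<le> sumsq n x"
  unfolding sumsq_def by (simp add: sum_nonneg)

lemma sumsq_dilate: "sumsq n (dilate n a x) = a\<^sup>2 * sumsq n x"
  by (simp add: sumsq_def dilate_def sum_distrib_left power_mult_distrib)

lemma coord_sum_Suc: "coord_sum (Suc n) x = coord_sum n x + x (Suc n)"
  by (simp add: coord_sum_def)

lemma sumsq_Suc: "sumsq (Suc n) x = sumsq n x + (x (Suc n))\<^sup>2"
  by (simp add: sumsq_def)

lemma coord_sum_upd: "n < k \<Longrightarrow> coord_sum n (x(k := y)) = coord_sum n x"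
  unfolding coord_sum_def by (intro sum.cong) auto

lemma sumsq_upd: "n < k \<Longrightarrow> sumsq n (x(k := y)) = sumsq n x"
  unfolding sumsq_def by (intro sum.cong) auto

text \<open>Both sides are determined by their values on boxes, where the integral of a product of functions of
  single coordinates factorizes.\<close>

lemma PiM_density:
  fixes f :: "'i \<Rightarrow> 'a \<Rightarrow> ennreal"
  assumes "finite I" and "product_sigma_finite M" and "product_sigma_finite (\<lambda>i. density (M i) (f i))"
    and [measurable]: "\<And>i. f i \<in> borel_measurable (M i)"
  shows "(\<Pi>\<^sub>M i\<in>I. density (M i) (f i)) = density (\<Pi>\<^sub>M i\<in>I. M i) (\<lambda>x. \<Prod>i\<in>I. f i (x i))"
proof -
  interpret A: product_sigma_finite M by fact
  interpret B: product_sigma_finite "\<lambda>i. density (M i) (f i)" by fact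
  have m[measurable]: "(\<lambda>x. \<Prod>i\<in>I. f i (x i)) \<in> borel_measurable (Pi\<^sub>M I M)"
    by (intro borel_measurable_prod_ennreal) measurable
  have "density (\<Pi>\<^sub>M i\<in>I. M i) (\<lambda>x. \<Prod>i\<in>I. f i (x i)) = (\<Pi>\<^sub>M i\<in>I. density (M i) (f i))"
  proof (rule B.PiM_eqI[OF assms(1)])
    show "sets (density (Pi\<^sub>M I M) (\<lambda>x. \<Prod>i\<in>I. f i (x i))) = sets (\<Pi>\<^sub>M i\<in>I. density (M i) (f i))"
      by (simp, intro sets_PiM_cong) auto
    fix S assume S: "\<And>i. i \<in> I \<Longrightarrow> S i \<in> sets (density (M i) (f i))"
    have S'[measurable]: "Pi\<^sub>E I S \<in> sets (Pi\<^sub>M I M)"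
      using S assms(1) by (intro sets_PiM_I_finite) auto
    have "emeasure (density (Pi\<^sub>M I M) (\<lambda>x. \<Prod>i\<in>I. f i (x i))) (Pi\<^sub>E I S)
        = (\<integral>\<^sup>+x. (\<Prod>i\<in>I. f i (x i)) * indicator (Pi\<^sub>E I S) x \<partial>Pi\<^sub>M I M)"
      by (subst emeasure_density) auto
    also have "\<dots> = (\<integral>\<^sup>+x. (\<Prod>i\<in>I. f i (x i) * indicator (S i) (x i)) \<partial>Pi\<^sub>M I M)"
    proof (intro nn_integral_cong)
      fix x assume "x \<in> space (Pi\<^sub>M I M)"
      then have "indicator (Pi\<^sub>E I S) x = (\<Prod>i\<in>I. indicator (S i) (x i) :: ennreal)"
        using assms(1) by (auto simp: indicator_def space_PiM PiE_iff)
      then show "(\<Prod>i\<in>I. f i (x i)) * indicator (Pi\<^sub>E I S) x = (\<Prod>i\<in>I. f i (x i) * indicator (S i) (x i))"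
        by (simp add: prod.distrib)
    qed
    also have "\<dots> = (\<Prod>i\<in>I. \<integral>\<^sup>+y. f i y * indicator (S i) y \<partial>M i)"
      using S by (intro A.product_nn_integral_prod assms(1)) auto
    also have "\<dots> = (\<Prod>i\<in>I. emeasure (density (M i) (f i)) (S i))"
      using S by (intro prod.cong refl) (auto simp: emeasure_density)
    finally show "emeasure (density (Pi\<^sub>M I M) (\<lambda>x. \<Prod>i\<in>I. f i (x i))) (Pi\<^sub>E I S) = \<dots>" .
  qed
  then show ?thesis by simp
qed

lemma leb_dilate:
  assumes "0 < a"
  shows "leb n = density (distr (leb n) (leb n) (dilate n a)) (\<lambda>_. ennreal (a ^ n))"
proof -
  interpret L: product_sigma_finite "\<lambda>_::nat. lborel :: real measure"
    by standard
  have sc[measurable]: "dilate n a \<in> leb n \<rightarrow>\<^sub>M leb n"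
    unfolding measurable_cong_sets[OF sets_leb sets_leb] by (rule dilate_measurable)
  have "density (distr (leb n) (leb n) (dilate n a)) (\<lambda>_. ennreal (a ^ n)) = leb n"
  proof (rule L.PiM_eqI)
    fix A :: "nat \<Rightarrow> real set" assume A: "\<And>i. i \<in> {1..n} \<Longrightarrow> A i \<in> sets lborel"
    have A'[measurable]: "Pi\<^sub>E {1..n} A \<in> sets (leb n)"
      using A by (intro sets_PiM_I_finite) auto
    have pre: "dilate n a -` Pi\<^sub>E {1..n} A \<inter> space (leb n) = (\<Pi>\<^sub>E i\<in>{1..n}. (*) a -` A i)"
      by (auto simp: dilate_def space_PiM PiE_iff)
    have meas: "(*) a -` A i \<in> sets lborel" if "i \<in> {1..n}" for i
      using measurable_sets[of "(*) a" borel borel "A i"] A[OF that] by simp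
    have one: "ennreal a * emeasure lborel ((*) a -` B) = emeasure lborel B" if [measurable]: "B \<in> sets borel" for B
    proof -
      have "emeasure lborel B = emeasure (density (distr lborel borel ((*) a)) (\<lambda>_. \<bar>a\<bar>)) B"
        using lborel_distr_mult'[of a] assms by simp
      also have "\<dots> = ennreal a * emeasure lborel ((*) a -` B)"
        using assms by (simp add: emeasure_density emeasure_distr nn_integral_cmult)
      finally show ?thesis by simp
    qed
    have "emeasure (density (distr (leb n) (leb n) (dilate n a)) (\<lambda>_. ennreal (a ^ n))) (Pi\<^sub>E {1..n} A)
        = ennreal (a ^ n) * emeasure (leb n) (\<Pi>\<^sub>E i\<in>{1..n}. (*) a -` A i)"
      by (simp add: emeasure_density emeasure_distr nn_integral_cmult pre del: One_nat_def)
    also have "\<dots> = (\<Prod>i\<in>{1..n}. ennreal a) * (\<Prod>i\<in>{1..n}. emeasure lborel ((*) a -` A i))"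
      using meas assms by (subst L.emeasure_PiM) (auto simp: ennreal_power)
    also have "\<dots> = (\<Prod>i\<in>{1..n}. emeasure lborel (A i))"
      unfolding prod.distrib[symmetric] using A one by (intro prod.cong) auto
    finally show "emeasure (density (distr (leb n) (leb n) (dilate n a)) (\<lambda>_. ennreal (a ^ n))) (Pi\<^sub>E {1..n} A) = \<dots>" .
  qed auto
  then show ?thesis by simp
qed

lemma nn_integral_leb_dilate:
  assumes "0 < a" and [measurable]: "f \<in> borel_measurable (coords n)"
  shows "(\<integral>\<^sup>+x. f x \<partial>leb n) = ennreal (a ^ n) * (\<integral>\<^sup>+x. f (dilate n a x) \<partial>leb n)"
proof -
  have sc: "dilate n a \<in> leb n \<rightarrow>\<^sub>M leb n"
    unfolding measurable_cong_sets[OF sets_leb sets_leb] by (rule dilate_measurable)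
  have f: "f \<in> borel_measurable (leb n)"
    unfolding measurable_leb by measurable
  show ?thesis
    by (subst leb_dilate[OF assms(1)], subst nn_integral_density)
       (use sc f in \<open>auto simp: nn_integral_cmult nn_integral_distr measurable_compose[OF sc f]\<close>)
qed

lemma gauss_prob: "0 < \<sigma> \<Longrightarrow> prob_space (gauss \<mu> \<sigma>)"
  by (rule prob_space_normal_density)

lemma gauss_product: "0 < \<sigma> \<Longrightarrow> product_prob_space (\<lambda>_. gauss \<mu> \<sigma>)"
  by (intro product_prob_spaceI gauss_prob)

lemma gauss_prod_prob: "0 < \<sigma> \<Longrightarrow> prob_space (gauss_prod n \<mu> \<sigma>)"
  by (intro prob_space_PiM gauss_prob)

lemma gauss_prod_density:
  assumes "0 < \<sigma>"
  shows "gauss_prod n \<mu> \<sigma> = density (leb n) (\<lambda>x. ennreal (\<Prod>i\<in>{1..n}. normal_density \<mu> \<sigma> (x i)))"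
proof -
  interpret product_prob_space "\<lambda>_::nat. gauss \<mu> \<sigma>" by (rule gauss_product[OF assms])
  have "gauss_prod n \<mu> \<sigma> = density (leb n) (\<lambda>x. \<Prod>i\<in>{1..n}. ennreal (normal_density \<mu> \<sigma> (x i)))"
    using product_sigma_finite_axioms
    by (intro PiM_density) (auto simp: product_sigma_finite_def lborel.sigma_finite_measure_axioms)
  then show ?thesis
    by (simp add: prod_ennreal)
qed

lemma std_normal_prod:
  "(\<Prod>i\<in>{1..n}. normal_density 0 1 (x i)) = (1 / sqrt (2 * pi)) ^ n * exp (- sumsq n x / 2)"
proof -
  have "(\<Prod>i\<in>{1..n}. normal_density 0 1 (x i)) = (\<Prod>i\<in>{1..n}. (1 / sqrt (2 * pi)) * exp (- (x i)\<^sup>2 / 2))"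
    by (simp add: normal_density_def)
  also have "\<dots> = (1 / sqrt (2 * pi)) ^ n * exp (\<Sum>i\<in>{1..n}. - (x i)\<^sup>2 / 2)"
    by (subst prod.distrib) (simp add: exp_sum)
  also have "(\<Sum>i\<in>{1..n}. - (x i)\<^sup>2 / 2) = - sumsq n x / 2"
    by (simp add: sumsq_def sum_negf sum_divide_distrib)
  finally show ?thesis .
qed

text \<open>Rescaling by the standard deviation turns \<open>N(\<mu>,\<sigma>\<^sup>2)\<close> into \<open>N(\<theta>,1)\<close> with \<open>\<theta> = \<mu> / \<sigma>\<close>, so after the
  rescaling only \<open>\<theta>\<close> is left in the likelihood ratio with respect to \<open>N(0,1)\<close>. The factor \<open>\<sigma> ^ n\<close> is the
  Jacobian.\<close>

lemma normal_prod_tilt: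
  assumes "0 < \<sigma>"
  shows "\<sigma> ^ n * (\<Prod>i\<in>{1..n}. normal_density \<mu> \<sigma> (dilate n \<sigma> x i))
    = (\<Prod>i\<in>{1..n}. normal_density 0 1 (x i)) * exp ((\<mu> / \<sigma>) * coord_sum n x - real n * (\<mu> / \<sigma>)\<^sup>2 / 2)"
proof -
  have one: "\<sigma> * normal_density \<mu> \<sigma> (\<sigma> * y) = normal_density 0 1 y * exp ((\<mu> / \<sigma>) * y - (\<mu> / \<sigma>)\<^sup>2 / 2)" for y
  proof -
    have e: "- (\<sigma> * y - \<mu>)\<^sup>2 / (2 * \<sigma>\<^sup>2) = - y\<^sup>2 / 2 + ((\<mu> / \<sigma>) * y - (\<mu> / \<sigma>)\<^sup>2 / 2)"
      using assms by (simp add: field_simps power2_eq_square)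
    have "sqrt (2 * pi * \<sigma>\<^sup>2) = \<sigma> * sqrt (2 * pi)"
      using assms by (simp add: real_sqrt_mult)
    then show ?thesis
      using assms unfolding normal_density_def e exp_add by simp
  qed
  have "\<sigma> ^ n * (\<Prod>i\<in>{1..n}. normal_density \<mu> \<sigma> (dilate n \<sigma> x i))
     = (\<Prod>i\<in>{1..n}. \<sigma> * normal_density \<mu> \<sigma> (\<sigma> * x i))"
    by (simp add: prod.distrib dilate_def)
  also have "\<dots> = (\<Prod>i\<in>{1..n}. normal_density 0 1 (x i)) * exp (\<Sum>i\<in>{1..n}. (\<mu> / \<sigma>) * x i - (\<mu> / \<sigma>)\<^sup>2 / 2)"
    by (simp only: one prod.distrib) (simp add: exp_sum)
  also have "(\<Sum>i\<in>{1..n}. (\<mu> / \<sigma>) * x i - (\<mu> / \<sigma>)\<^sup>2 / 2) = (\<mu> / \<sigma>) * coord_sum n x - real n * (\<mu> / \<sigma>)\<^sup>2 / 2"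
    by (simp add: sum_subtractf sum_distrib_left coord_sum_def)
  finally show ?thesis .
qed

text \<open>A measure on the line whose mass below \<open>r\<close> is a fixed function of \<open>r\<close> up to a constant is determined by
  this constant, because the rays \<open>{..<r}\<close> generate the Borel sets. Open rays are used so that the
  squared radius has no mass below \<open>0\<close>, whatever the dimension (in dimension \<open>0\<close> it sits at \<open>0\<close>).\<close>

lemma homogeneous_measures_proportional:
  fixes \<nu>1 \<nu>2 :: "real measure" and s :: "real \<Rightarrow> ennreal"
  assumes sets: "sets \<nu>1 = sets borel" "sets \<nu>2 = sets borel"
    and h1: "\<And>r. emeasure \<nu>1 {..<r} = s r * a1"
    and h2: "\<And>r. emeasure \<nu>2 {..<r} = s r * a2"
    and fin: "\<And>r. s r < \<infinity>" "a1 < \<infinity>" "a2 < \<infinity>"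
    and f: "f \<in> borel_measurable borel"
  shows "a2 * (\<integral>\<^sup>+q. f q \<partial>\<nu>1) = a1 * (\<integral>\<^sup>+q. f q \<partial>\<nu>2)"
proof -
  define E :: "real set set" where "E = range (\<lambda>r. {..<r})"
  have borel: "sets (borel :: real measure) = sigma_sets UNIV E"
    by (subst borel_eq_lessThan) (simp add: E_def lessThan_def eucl_less_def)
  have [measurable]: "f \<in> borel_measurable \<nu>1" "f \<in> borel_measurable \<nu>2"
    using f sets by (simp_all cong: measurable_cong_sets)
  have rays[measurable]: "{..<r} \<in> sets \<nu>1" "{..<r} \<in> sets \<nu>2" for r
    using sets by simp_all
  have "density \<nu>1 (\<lambda>_. a2) = density \<nu>2 (\<lambda>_. a1)"
  proof (rule measure_eqI_generator_eq[where E = E and \<Omega> = UNIV and A = "\<lambda>i. {..<real i}"])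
    show "Int_stable E"
      unfolding E_def Int_stable_def
    proof safe
      fix a b :: real
      show "{..<a} \<inter> {..<b} \<in> range lessThan"
        by (auto simp: image_iff intro!: exI[of _ "min a b"])
    qed
    fix X assume "X \<in> E"
    then obtain r where X: "X = {..<r}" by (auto simp: E_def)
    show "emeasure (density \<nu>1 (\<lambda>_. a2)) X = emeasure (density \<nu>2 (\<lambda>_. a1)) X"
      unfolding X using rays by (simp add: emeasure_density nn_integral_cmult h1 h2 ac_simps)
  next
    show "(\<Union>i. {..<real i}) = UNIV"
      using reals_Archimedean2 by auto
    show "emeasure (density \<nu>1 (\<lambda>_. a2)) {..<real i} \<noteq> \<infinity>" for i
      using rays fin by (simp add: emeasure_density nn_integral_cmult h1 ennreal_mult_eq_top_iff less_top)
  qed (auto simp: sets borel E_def)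
  then have "(\<integral>\<^sup>+q. f q \<partial>density \<nu>1 (\<lambda>_. a2)) = (\<integral>\<^sup>+q. f q \<partial>density \<nu>2 (\<lambda>_. a1))"
    by simp
  then show ?thesis
    by (simp add: nn_integral_density nn_integral_cmult)
qed

section \<open>Independence of radius and direction\<close>

definition dilation_invariant :: "nat \<Rightarrow> (nat \<Rightarrow> real) set \<Rightarrow> bool" where
  "dilation_invariant n B \<longleftrightarrow> B \<in> sets (coords n) \<and>
     (\<forall>a>0. \<forall>x\<in>space (coords n). dilate n a x \<in> B \<longleftrightarrow> x \<in> B)"

lemma dilation_invariant_space: "dilation_invariant n (space (coords n))"
  unfolding dilation_invariant_def by (auto simp: dilate_def space_PiM)

text \<open>Lebesgue measure scales by \<open>a ^ n\<close> under a dilation by \<open>a\<close>; with \<open>a = sqrt r\<close> the part of a cone in the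
  ball of squared radius \<open>r\<close> is the image of its part in the unit ball.\<close>

lemma leb_shell:
  assumes B: "dilation_invariant n B"
  shows "(\<integral>\<^sup>+x. indicator B x * indicator {..<r} (sumsq n x) \<partial>leb n)
     = ennreal (if r \<le> 0 then 0 else sqrt r ^ n) * (\<integral>\<^sup>+x. indicator B x * indicator {..<1} (sumsq n x) \<partial>leb n)"
proof (cases "r \<le> 0")
  case True
  then have "indicator {..<r} (sumsq n x) = (0::ennreal)" for x
    using sumsq_nonneg[of n x] by (auto simp: indicator_def)
  then show ?thesis using True by simp
next
  case False
  have [measurable]: "B \<in> sets (coords n)"
    using B by (simp add: dilation_invariant_def)
  have "(\<integral>\<^sup>+x. indicator B x * indicator {..<r} (sumsq n x) \<partial>leb n)
      = ennreal (sqrt r ^ n) * (\<integral>\<^sup>+x. indicator B (dilate n (sqrt r) x) * indicator {..<r} (sumsq n (dilate n (sqrt r) x)) \<partial>leb n)"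
    using False by (intro nn_integral_leb_dilate) (simp, measurable)
  also have "(\<integral>\<^sup>+x. indicator B (dilate n (sqrt r) x) * indicator {..<r} (sumsq n (dilate n (sqrt r) x)) \<partial>leb n)
     = (\<integral>\<^sup>+x. indicator B x * indicator {..<1} (sumsq n x) \<partial>leb n)"
  proof (intro nn_integral_cong)
    fix x assume "x \<in> space (leb n)"
    then have "x \<in> space (coords n)" by (simp add: space_PiM)
    then have "dilate n (sqrt r) x \<in> B \<longleftrightarrow> x \<in> B"
      using B False by (auto simp: dilation_invariant_def)
    moreover have "sumsq n (dilate n (sqrt r) x) < r \<longleftrightarrow> sumsq n x < 1"
      using False by (simp add: sumsq_dilate mult_less_cancel_left2)
    ultimately show "indicator B (dilate n (sqrt r) x) * indicator {..<r} (sumsq n (dilate n (sqrt r) x))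
      = (indicator B x * indicator {..<1} (sumsq n x) :: ennreal)"
      by (auto simp: indicator_def)
  qed
  finally show ?thesis using False by simp
qed

lemma leb_unit_ball_finite: "(\<integral>\<^sup>+x. indicator {..<1} (sumsq n x) \<partial>leb n) < \<infinity>"
proof -
  interpret L: product_sigma_finite "\<lambda>_::nat. lborel :: real measure" by standard
  have "(\<integral>\<^sup>+x. indicator {..<1} (sumsq n x) \<partial>leb n) \<le> (\<integral>\<^sup>+x. indicator (\<Pi>\<^sub>E i\<in>{1..n}. {-1..1}) x \<partial>leb n)"
  proof (intro nn_integral_mono)
    fix x assume x: "x \<in> space (leb n)"
    have "x \<in> (\<Pi>\<^sub>E i\<in>{1..n}. {-1..1})" if "sumsq n x < 1"
    proof -
      have "x i \<in> {-1..1}" if i: "i \<in> {1..n}" for i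
      proof -
        have "(x i)\<^sup>2 \<le> sumsq n x"
          unfolding sumsq_def using i by (intro member_le_sum) auto
        then have "\<bar>x i\<bar> \<le> 1"
          using \<open>sumsq n x < 1\<close> by (subst abs_square_le_1[symmetric]) linarith
        then show ?thesis by auto
      qed
      then show ?thesis using x by (auto simp: space_PiM PiE_iff)
    qed
    then show "indicator {..<1} (sumsq n x) \<le> (indicator (\<Pi>\<^sub>E i\<in>{1..n}. {-1..1}) x :: ennreal)"
      by (auto simp: indicator_def)
  qed
  also have "\<dots> = (\<Prod>i\<in>{1..n}. emeasure lborel {-1..1::real})"
    by (subst nn_integral_indicator, intro sets_PiM_I_finite)
      (simp_all add: L.emeasure_PiM)
  also have "\<dots> < \<infinity>"
    by (simp add: ennreal_power[symmetric] power_less_top_ennreal)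
  finally show ?thesis .
qed

lemma leb_unit_ball_pos: "0 < (\<integral>\<^sup>+x. indicator {..<1} (sumsq n x) \<partial>leb n)"
proof -
  interpret L: product_sigma_finite "\<lambda>_::nat. lborel :: real measure" by standard
    \<comment> \<open>A cube of this half-width lies inside the unit ball.\<close>define e where "e = 1 / (real n + 1)"
  have e: "0 < e" "real n * e\<^sup>2 < 1"
    by (auto simp: e_def power2_eq_square field_simps add_pos_nonneg)
  have "0 < ennreal (2 * e) ^ n"
    using e by (simp add: ennreal_power)
  also have "\<dots> = (\<Prod>i\<in>{1..n}. emeasure lborel {-e..e})"
    using e by simp
  also have "\<dots> = (\<integral>\<^sup>+x. indicator (\<Pi>\<^sub>E i\<in>{1..n}. {-e..e}) x \<partial>leb n)"
    by (subst nn_integral_indicator, intro sets_PiM_I_finite)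
      (simp_all add: L.emeasure_PiM)
  also have "\<dots> \<le> (\<integral>\<^sup>+x. indicator {..<1} (sumsq n x) \<partial>leb n)"
  proof (intro nn_integral_mono)
    fix x
    have "sumsq n x < 1" if "x \<in> (\<Pi>\<^sub>E i\<in>{1..n}. {-e..e})"
    proof -
      have "sumsq n x \<le> (\<Sum>i=1..n. e\<^sup>2)"
        unfolding sumsq_def using that e(1)
        by (intro sum_mono) (fastforce simp: PiE_iff abs_le_square_iff[symmetric] abs_le_iff)
      then show ?thesis using e by simp
    qed
    then show "indicator (\<Pi>\<^sub>E i\<in>{1..n}. {-e..e}) x \<le> (indicator {..<1} (sumsq n x) :: ennreal)"
      by (auto simp: indicator_def)
  qed
  finally show ?thesis .
qed

text \<open>Restricted to any cone, the squared radius thus has the same distribution under Lebesgue measure up to a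
  constant. The comparison measure \<open>\<nu>\<close> is left open because two choices are needed: the squared radius on
  the whole space gives independence, and an explicit power density gives the chi-square law.\<close>

lemma leb_sumsq_proportional:
  fixes \<nu> :: "real measure"
  assumes B: "dilation_invariant n B" and \<nu>: "sets \<nu> = sets borel"
    and h: "\<And>r. emeasure \<nu> {..<r} = ennreal (if r \<le> 0 then 0 else sqrt r ^ n) * b" "b < \<infinity>"
    and f[measurable]: "f \<in> borel_measurable borel"
  shows "b * (\<integral>\<^sup>+x. indicator B x * f (sumsq n x) \<partial>leb n)
     = (\<integral>\<^sup>+x. indicator B x * indicator {..<1} (sumsq n x) \<partial>leb n) * (\<integral>\<^sup>+q. f q \<partial>\<nu>)"
proof -
  have B'[measurable]: "B \<in> sets (leb n)"
    using B unfolding dilation_invariant_def sets_leb by simp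
  have Q[measurable]: "sumsq n \<in> borel_measurable (leb n)"
    unfolding measurable_leb by measurable
  define \<nu>B where "\<nu>B = distr (density (leb n) (indicator B)) borel (sumsq n)"
  have int: "(\<integral>\<^sup>+q. g q \<partial>\<nu>B) = (\<integral>\<^sup>+x. indicator B x * g (sumsq n x) \<partial>leb n)"
    if [measurable]: "g \<in> borel_measurable borel" for g
    unfolding \<nu>B_def using B' Q by (subst nn_integral_distr) (auto simp: nn_integral_density)
  have ray: "emeasure \<nu>B {..<r} = ennreal (if r \<le> 0 then 0 else sqrt r ^ n) * (\<integral>\<^sup>+x. indicator B x * indicator {..<1} (sumsq n x) \<partial>leb n)" for r
    by (subst leb_shell[OF B, symmetric], subst int[symmetric]) (auto simp: \<nu>B_def)
  have "(\<integral>\<^sup>+x. indicator B x * indicator {..<1} (sumsq n x) \<partial>leb n) \<le> (\<integral>\<^sup>+x. indicator {..<1} (sumsq n x) \<partial>leb n)"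
    by (intro nn_integral_mono) (auto simp: indicator_def)
  then have fin: "(\<integral>\<^sup>+x. indicator B x * indicator {..<1} (sumsq n x) \<partial>leb n) < \<infinity>"
    using leb_unit_ball_finite[of n] by (rule le_less_trans)
  show ?thesis
    using homogeneous_measures_proportional[OF _ \<nu> ray h(1) _ fin h(2) f]
    unfolding int[OF f] by (simp add: \<nu>B_def)
qed

lemma nn_integral_std_gauss_prod:
  assumes [measurable]: "B \<in> sets (coords n)" "f \<in> borel_measurable borel"
  shows "(\<integral>\<^sup>+x. indicator B x * f (sumsq n x) \<partial>gauss_prod n 0 1)
     = (\<integral>\<^sup>+x. indicator B x * (ennreal ((1 / sqrt (2 * pi)) ^ n * exp (- sumsq n x / 2)) * f (sumsq n x)) \<partial>leb n)"
proof -
  have [measurable]: "sumsq n \<in> borel_measurable (leb n)" "B \<in> sets (leb n)"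
    unfolding measurable_leb sets_leb by measurable
  show ?thesis
    unfolding gauss_prod_density[of 1, simplified] std_normal_prod
    by (subst nn_integral_density) (auto simp: ac_simps)
qed

text \<open>The standard Gaussian density depends on the radius only, so the proportionality of the radial laws
  under Lebesgue measure carries over. The constants cancel: their ratio is the Gaussian probability of the
  cone, as the test function \<open>1\<close> shows. This is the instance of Basu's theorem that the proof needs.\<close>

lemma std_gauss_sumsq_indep_dilation_invariant:
  assumes B: "dilation_invariant n B" and f[measurable]: "f \<in> borel_measurable borel"
  shows "(\<integral>\<^sup>+x. indicator B x * f (sumsq n x) \<partial>gauss_prod n 0 1)
    = emeasure (gauss_prod n 0 1) B * (\<integral>\<^sup>+x. f (sumsq n x) \<partial>gauss_prod n 0 1)"
proof -
  let ?G = "gauss_prod n 0 1" and ?U = "space (coords n)"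
  interpret G: prob_space ?G by (rule gauss_prod_prob) simp
  have B'[measurable]: "B \<in> sets (coords n)"
    using B by (simp add: dilation_invariant_def)
  define J where "J = (\<lambda>B g. \<integral>\<^sup>+x. indicator B x * g (sumsq n x) \<partial>leb n)"
  let ?e = "\<lambda>q. ennreal ((1 / sqrt (2 * pi)) ^ n * exp (- q / 2))"
  let ?V = "J ?U (indicator {..<1})"
  have V: "?V = (\<integral>\<^sup>+x. indicator {..<1} (sumsq n x) \<partial>leb n)"
    unfolding J_def by (intro nn_integral_cong) (auto simp: indicator_def space_PiM)
  have Vpos: "0 < ?V" "?V < \<infinity>"
    unfolding V by (rule leb_unit_ball_pos leb_unit_ball_finite)+
  define \<nu> where "\<nu> = distr (leb n) borel (sumsq n)"
  have Q[measurable]: "sumsq n \<in> borel_measurable (leb n)"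
    unfolding measurable_leb by measurable
  have \<nu>: "(\<integral>\<^sup>+q. g q \<partial>\<nu>) = J ?U g" if [measurable]: "g \<in> borel_measurable borel" for g
    unfolding \<nu>_def J_def
    by (subst nn_integral_distr) (auto intro!: nn_integral_cong simp: space_PiM)
  have ray: "emeasure \<nu> {..<r} = ennreal (if r \<le> 0 then 0 else sqrt r ^ n) * ?V" for r
    using leb_shell[OF dilation_invariant_space, of n r] \<nu>[of "indicator {..<r}"]
    by (simp add: J_def \<nu>_def)
    \<comment> \<open>Both sides compare the cone with the whole space, normalized by their parts in the unit ball.\<close>have shell: "?V * J B g = J B (indicator {..<1}) * J ?U g"
    if [measurable]: "g \<in> borel_measurable borel" for g
    using leb_sumsq_proportional[OF B _ ray Vpos(2), of g] \<nu>[of g]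
    by (simp add: \<nu>_def J_def)
  have GJ: "(\<integral>\<^sup>+x. indicator A x * g (sumsq n x) \<partial>?G) = J A (\<lambda>q. ?e q * g q)"
    if "A \<in> sets (coords n)" "g \<in> borel_measurable borel" for g A
    unfolding J_def using nn_integral_std_gauss_prod[OF that] .
  have U: "(\<integral>\<^sup>+x. g (sumsq n x) \<partial>?G) = (\<integral>\<^sup>+x. indicator ?U x * g (sumsq n x) \<partial>?G)" for g :: "real \<Rightarrow> ennreal"
    by (intro nn_integral_cong) (auto simp: indicator_def space_PiM)
  have BG: "emeasure ?G B = (\<integral>\<^sup>+x. indicator B x * 1 \<partial>?G)"
    using sets_gauss_prod[of n 0 1] by simp
  have one: "(\<integral>\<^sup>+x. indicator ?U x * 1 \<partial>?G) = 1"
    using U[of "\<lambda>_. 1"] G.emeasure_space_1 by simp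
  have JU: "J ?U (\<lambda>q. ?e q * 1) = 1"
    using one by (subst GJ[symmetric]) (auto simp: space_PiM)
  have "?V * J B (\<lambda>q. ?e q * f q) = J B (indicator {..<1}) * J ?U (\<lambda>q. ?e q * f q)"
    by (rule shell) measurable
  also have "J B (indicator {..<1}) = ?V * J B (\<lambda>q. ?e q * 1)"
    using shell[of "\<lambda>q. ?e q * 1"] JU by simp
  finally have "?V * J B (\<lambda>q. ?e q * f q) = ?V * (J B (\<lambda>q. ?e q * 1) * J ?U (\<lambda>q. ?e q * f q))"
    by (simp only: mult.assoc)
  then have "J B (\<lambda>q. ?e q * f q) = J B (\<lambda>q. ?e q * 1) * J ?U (\<lambda>q. ?e q * f q)"
    using Vpos by (subst (asm) ennreal_mult_cancel_left) auto
  then show ?thesis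
    unfolding U[of f] BG GJ[OF B' f] GJ[OF sets.top f] GJ[OF B' borel_measurable_const[of 1]] .
qed

text \<open>The Gamma integral with rate \<open>b\<close>.\<close>

lemma nn_integral_powr_exp:
  assumes p: "0 < p" and b: "0 < (b::real)"
  shows "(\<integral>\<^sup>+q. indicator {0<..} q * ennreal (q powr (p - 1) * exp (- b * q)) \<partial>lborel) = ennreal (Gamma p / b powr p)"
proof -
  have eq: "indicator {0<..} q * ennreal (q powr (p - 1) * exp (- b * q))
      = ennreal (1 / b powr (p - 1)) * ennreal (indicator {0..} (0 + b * q) * (0 + b * q) powr (p - 1) / exp (0 + b * q))" for q
    using b by (cases "q > 0"; cases "q = 0")
      (auto simp: powr_mult exp_minus field_simps ennreal_mult'[symmetric] indicator_def zero_le_mult_iff)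
  have "ennreal (Gamma p) = ennreal \<bar>b\<bar> * (\<integral>\<^sup>+q. ennreal (indicator {0..} (0 + b * q) * (0 + b * q) powr (p - 1) / exp (0 + b * q)) \<partial>lborel)"
    unfolding Gamma_conv_nn_integral_real[OF p]
    using b by (intro nn_integral_real_affine) auto
  then have "ennreal (1 / b) * ennreal (Gamma p) = ennreal (1 / b) * ennreal b * (\<integral>\<^sup>+q. ennreal (indicator {0..} (0 + b * q) * (0 + b * q) powr (p - 1) / exp (0 + b * q)) \<partial>lborel)"
    using b by (simp add: mult.assoc)
  also have "ennreal (1 / b) * ennreal b = 1"
    using b by (simp add: ennreal_mult'[symmetric])
  finally have *: "(\<integral>\<^sup>+q. ennreal (indicator {0..} (0 + b * q) * (0 + b * q) powr (p - 1) / exp (0 + b * q)) \<partial>lborel)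
     = ennreal (Gamma p / b)"
    using b p by (simp add: ennreal_mult'[symmetric])
  have "(\<integral>\<^sup>+q. indicator {0<..} q * ennreal (q powr (p - 1) * exp (- b * q)) \<partial>lborel)
     = ennreal (1 / b powr (p - 1)) * ennreal (Gamma p / b)"
    unfolding eq by (subst nn_integral_cmult) (simp, simp only: *)
  also have "\<dots> = ennreal (Gamma p / b powr p)"
    using b p by (simp add: ennreal_mult'[symmetric] powr_diff)
  finally show ?thesis .
qed

text \<open>Under Lebesgue measure the squared radius has density proportional to \<open>q powr (n/2 - 1)\<close>, and the
  Gaussian weight contributes \<open>exp (-q/2)\<close>. The normalizing constant is not computed from the volume of the
  ball but from the total mass \<open>1\<close>.\<close>

lemma std_gauss_sumsq_chi_square_law:
  assumes n: "0 < n" and f[measurable]: "f \<in> borel_measurable borel"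
  shows "(\<integral>\<^sup>+x. f (sumsq n x) \<partial>gauss_prod n 0 1)
    = ennreal (1 / (2 powr (real n / 2) * Gamma (real n / 2))) *
      (\<integral>\<^sup>+q. indicator {0<..} q * ennreal (q powr (real n / 2 - 1) * exp (- (1/2) * q)) * f q \<partial>lborel)"
proof -
  let ?G = "gauss_prod n 0 1" and ?U = "space (coords n)"
  interpret G: prob_space ?G by (rule gauss_prod_prob) simp
  define p where "p = real n / 2"
  have p: "0 < p" using n by (simp add: p_def)
  let ?w = "\<lambda>q. indicator {0<..} q * ennreal (q powr (p - 1))"
  define \<nu> where "\<nu> = density lborel ?w"
  have ray: "emeasure \<nu> {..<r} = ennreal (if r \<le> 0 then 0 else sqrt r ^ n) * ennreal (1 / p)" for r
  proof (cases "r \<le> 0")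
    case True
    then have w: "?w q * indicator {..<r} q = 0" for q by (auto simp: indicator_def)
    have "emeasure \<nu> {..<r} = (\<integral>\<^sup>+q. ?w q * indicator {..<r} q \<partial>lborel)"
      unfolding \<nu>_def by (subst emeasure_density) auto
    then show ?thesis using True unfolding w by simp
  next
    case False
    have "emeasure \<nu> {..<r} = (\<integral>\<^sup>+q. ennreal (indicator {0..r} q * q powr (p - 1)) \<partial>lborel)"
      unfolding \<nu>_def
    proof (subst emeasure_density, simp, simp, intro nn_integral_cong_AE)
      have "AE q in lborel. q \<noteq> r" "AE q in lborel. q \<noteq> (0::real)"
        by (rule AE_lborel_singleton)+
      then show "AE q in lborel. ?w q * indicator {..<r} q = ennreal (indicator {0..r} q * q powr (p - 1))"
        by eventually_elim (auto simp: indicator_def)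
    qed
    also have "\<dots> = ennreal (r powr p / p)"
    proof -
      have "((\<lambda>q. q powr (p - 1)) has_integral (r powr (p - 1 + 1) / (p - 1 + 1))) {0..r}"
        using False p by (intro has_integral_powr_from_0) auto
      then show ?thesis
        using nn_integral_has_integral_lebesgue[of "{0..r}" "\<lambda>q. q powr (p - 1)" "r powr p / p"] by simp
    qed
    also have "r powr p = sqrt r ^ n"
      using False by (simp add: p_def powr_half_sqrt[symmetric] powr_realpow[symmetric] powr_powr)
    finally show ?thesis
      using False p by (simp add: ennreal_mult'[symmetric])
  qed
  let ?V = "\<integral>\<^sup>+x. indicator ?U x * indicator {..<1} (sumsq n x) \<partial>leb n"
  let ?c = "(1 / sqrt (2 * pi)) ^ n"
  have U: "(\<integral>\<^sup>+x. g (sumsq n x) \<partial>?G) = (\<integral>\<^sup>+x. indicator ?U x * g (sumsq n x) \<partial>?G)" for g :: "real \<Rightarrow> ennreal"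
    by (intro nn_integral_cong) (auto simp: indicator_def space_PiM)
  have main: "ennreal (1 / p) * (\<integral>\<^sup>+x. g (sumsq n x) \<partial>?G)
     = ?V * ennreal ?c * (\<integral>\<^sup>+q. indicator {0<..} q * ennreal (q powr (p - 1) * exp (- (1/2) * q)) * g q \<partial>lborel)"
    if [measurable]: "g \<in> borel_measurable borel" for g
  proof -
    have "ennreal (1 / p) * (\<integral>\<^sup>+x. g (sumsq n x) \<partial>?G)
      = ennreal (1 / p) * (\<integral>\<^sup>+x. indicator ?U x * (ennreal (?c * exp (- sumsq n x / 2)) * g (sumsq n x)) \<partial>leb n)"
      unfolding U by (subst nn_integral_std_gauss_prod) auto
    also have "\<dots> = ?V * (\<integral>\<^sup>+q. ennreal (?c * exp (- q / 2)) * g q \<partial>\<nu>)"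
      by (rule leb_sumsq_proportional[OF dilation_invariant_space _ ray]) (auto simp: \<nu>_def)
    also have "(\<integral>\<^sup>+q. ennreal (?c * exp (- q / 2)) * g q \<partial>\<nu>)
      = (\<integral>\<^sup>+q. ennreal ?c * (indicator {0<..} q * ennreal (q powr (p - 1) * exp (- (1/2) * q)) * g q) \<partial>lborel)"
      unfolding \<nu>_def by (subst nn_integral_density)
        (auto intro!: nn_integral_cong simp: ennreal_mult' ac_simps)
    also have "\<dots> = ennreal ?c * (\<integral>\<^sup>+q. indicator {0<..} q * ennreal (q powr (p - 1) * exp (- (1/2) * q)) * g q \<partial>lborel)"
      by (rule nn_integral_cmult) measurable
    finally show ?thesis by (simp only: mult.assoc)
  qed
  define K where "K = ennreal p * (?V * ennreal ?c)"
  have p1: "ennreal p * ennreal (1 / p) = 1"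
    using p by (simp add: ennreal_mult'[symmetric])
  have main': "(\<integral>\<^sup>+x. g (sumsq n x) \<partial>?G)
     = K * (\<integral>\<^sup>+q. indicator {0<..} q * ennreal (q powr (p - 1) * exp (- (1/2) * q)) * g q \<partial>lborel)"
    if "g \<in> borel_measurable borel" for g
    using arg_cong[OF main[OF that], of "\<lambda>z. ennreal p * z"]
    unfolding mult.assoc[symmetric] p1 K_def by simp
  have "1 = K * ennreal (Gamma p / (1/2) powr p)"
    using main'[of "\<lambda>_. 1"] nn_integral_powr_exp[OF p, of "1/2"] G.emeasure_space_1 by simp
  also have "Gamma p / (1/2) powr p = 2 powr p * Gamma p"
    by (simp add: powr_divide)
  finally have "1 * ennreal (1 / (2 powr p * Gamma p)) = K * ennreal (2 powr p * Gamma p) * ennreal (1 / (2 powr p * Gamma p))"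
    by simp
  also have "\<dots> = K * (ennreal (2 powr p * Gamma p) * ennreal (1 / (2 powr p * Gamma p)))"
    by (simp add: mult.assoc)
  also have "ennreal (2 powr p * Gamma p) * ennreal (1 / (2 powr p * Gamma p)) = ennreal 1"
    using Gamma_real_pos[OF p] by (subst ennreal_mult'[symmetric]) auto
  finally have "K = ennreal (1 / (2 powr p * Gamma p))" by simp
  then show ?thesis using main'[OF f] by (simp add: p_def)
qed

section \<open>Student's law\<close>

lemma nn_integral_gauss:
  "f \<in> borel_measurable borel \<Longrightarrow> (\<integral>\<^sup>+x. f x \<partial>gauss \<mu> \<sigma>) = (\<integral>\<^sup>+x. ennreal (normal_density \<mu> \<sigma> x) * f x \<partial>lborel)"
  by (subst nn_integral_density) auto

lemma std_normal_rotate: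
  fixes c s :: real
  assumes "c\<^sup>2 + s\<^sup>2 = 1"
  shows "normal_density 0 1 (c * a - s * b) * normal_density 0 1 (s * a + c * b)
    = normal_density 0 1 a * normal_density 0 1 b"
proof -
  have "(c * a - s * b)\<^sup>2 + (s * a + c * b)\<^sup>2 = (c\<^sup>2 + s\<^sup>2) * (a\<^sup>2 + b\<^sup>2)"
    by (simp add: power2_eq_square algebra_simps)
  then have "- (c * a - s * b)\<^sup>2 / 2 + - (s * a + c * b)\<^sup>2 / 2 = - a\<^sup>2 / 2 + - b\<^sup>2 / 2"
    using assms by simp
  then have "exp (- (c * a - s * b)\<^sup>2 / 2) * exp (- (s * a + c * b)\<^sup>2 / 2) = exp (- a\<^sup>2 / 2) * exp (- b\<^sup>2 / 2)"
    by (simp only: exp_add[symmetric])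
  then show ?thesis by (simp add: normal_density_def)
qed

text \<open>Invariance of the planar Gaussian law under a rotation, obtained from two one-dimensional substitutions:
  first \<open>t = c a + s x\<close> in place of \<open>x\<close>, then \<open>b = (c t - a) / s\<close> in place of \<open>a\<close>. Dividing by \<open>s\<close> is why
  it must not vanish.\<close>

lemma std_gauss_rotation:
  fixes f :: "real \<Rightarrow> real \<Rightarrow> ennreal"
  assumes cs: "c\<^sup>2 + s\<^sup>2 = 1" and s: "0 < s"
    and f[measurable]: "case_prod f \<in> borel_measurable (borel \<Otimes>\<^sub>M borel)"
  shows "(\<integral>\<^sup>+a. \<integral>\<^sup>+x. f (c * a + s * x) (c * x - s * a) \<partial>gauss 0 1 \<partial>gauss 0 1)
    = (\<integral>\<^sup>+a. \<integral>\<^sup>+b. f a b \<partial>gauss 0 1 \<partial>gauss 0 1)"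
proof -
  let ?n = "\<lambda>x. ennreal (normal_density 0 1 x)"
  have inner: "(\<integral>\<^sup>+x. ?n x * f (c * a + s * x) (c * x - s * a) \<partial>lborel)
     = ennreal (1 / s) * (\<integral>\<^sup>+t. ?n ((t - c * a) / s) * f t ((c * t - a) / s) \<partial>lborel)" for a
  proof -
    have 1: "c * a + s * (- c * a / s + 1 / s * t) = t" for t
      using s by (simp add: field_simps)
    have 2: "c * (- c * a / s + 1 / s * t) - s * a = (c * t - a) / s" for t
    proof -
      have "c * (- c * a / s + 1 / s * t) - s * a = (c * t - (c\<^sup>2 + s\<^sup>2) * a) / s"
        using s by (simp add: field_simps power2_eq_square)
      then show ?thesis using cs by simp
    qed
    have 3: "- c * a / s + 1 / s * t = (t - c * a) / s" for t
      using s by (simp add: field_simps)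
    have "(\<integral>\<^sup>+x. ?n x * f (c * a + s * x) (c * x - s * a) \<partial>lborel)
      = ennreal \<bar>1 / s\<bar> * (\<integral>\<^sup>+t. ?n (- c * a / s + 1 / s * t) * f (c * a + s * (- c * a / s + 1 / s * t)) (c * (- c * a / s + 1 / s * t) - s * a) \<partial>lborel)"
      using s by (intro nn_integral_real_affine[where c = "1 / s" and t = "- c * a / s"]) auto
    then show ?thesis unfolding 1 2 unfolding 3 using s by simp
  qed
  have outer: "(\<integral>\<^sup>+a. ?n a * (?n ((t - c * a) / s) * f t ((c * t - a) / s)) \<partial>lborel)
     = ennreal s * (\<integral>\<^sup>+b. ?n t * (?n b * f t b) \<partial>lborel)" for t
  proof -
    have 1: "(c * t - (c * t + - s * b)) / s = b" for b
      using s by (simp add: field_simps)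
    have 2: "(t - c * (c * t + - s * b)) / s = s * t + c * b" for b
    proof -
      have "(t - c * (c * t + - s * b)) / s = ((1 - c\<^sup>2) * t + c * s * b) / s"
        by (simp add: field_simps power2_eq_square)
      also have "1 - c\<^sup>2 = s\<^sup>2" using cs by simp
      finally show ?thesis using s by (simp add: field_simps power2_eq_square)
    qed
    have "(\<integral>\<^sup>+a. ?n a * (?n ((t - c * a) / s) * f t ((c * t - a) / s)) \<partial>lborel)
      = ennreal \<bar>- s\<bar> * (\<integral>\<^sup>+b. ?n (c * t + - s * b) * (?n ((t - c * (c * t + - s * b)) / s) * f t ((c * t - (c * t + - s * b)) / s)) \<partial>lborel)"
      using s by (intro nn_integral_real_affine[where c = "- s" and t = "c * t"]) auto
    also have "\<dots> = ennreal s * (\<integral>\<^sup>+b. ?n t * (?n b * f t b) \<partial>lborel)"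
      unfolding 1 2 using s std_normal_rotate[OF cs, of t]
      by (simp add: mult.assoc[symmetric] ennreal_mult'[symmetric])
    finally show ?thesis .
  qed
  have "(\<integral>\<^sup>+a. \<integral>\<^sup>+x. f (c * a + s * x) (c * x - s * a) \<partial>gauss 0 1 \<partial>gauss 0 1)
     = (\<integral>\<^sup>+a. ?n a * (ennreal (1 / s) * (\<integral>\<^sup>+t. ?n ((t - c * a) / s) * f t ((c * t - a) / s) \<partial>lborel)) \<partial>lborel)"
    by (simp add: nn_integral_gauss inner)
  also have "\<dots> = (\<integral>\<^sup>+a. \<integral>\<^sup>+t. ennreal (1 / s) * (?n a * (?n ((t - c * a) / s) * f t ((c * t - a) / s))) \<partial>lborel \<partial>lborel)"
    by (simp add: nn_integral_cmult[symmetric] ac_simps)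
  also have "\<dots> = (\<integral>\<^sup>+t. \<integral>\<^sup>+a. ennreal (1 / s) * (?n a * (?n ((t - c * a) / s) * f t ((c * t - a) / s))) \<partial>lborel \<partial>lborel)"
    by (intro lborel_pair.Fubini') measurable
  also have "\<dots> = (\<integral>\<^sup>+t. ennreal (1 / s) * (ennreal s * (\<integral>\<^sup>+b. ?n t * (?n b * f t b) \<partial>lborel)) \<partial>lborel)"
    by (subst nn_integral_cmult) (simp_all add: outer)
  also have "\<dots> = (\<integral>\<^sup>+t. (\<integral>\<^sup>+b. ?n t * (?n b * f t b) \<partial>lborel) \<partial>lborel)"
    using s by (simp add: mult.assoc[symmetric] ennreal_mult'[symmetric])
  also have "\<dots> = (\<integral>\<^sup>+a. \<integral>\<^sup>+b. f a b \<partial>gauss 0 1 \<partial>gauss 0 1)"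
    by (simp add: nn_integral_gauss nn_integral_cmult)
  finally show ?thesis .
qed

lemma nn_integral_gauss_prod_Suc:
  assumes \<sigma>: "0 < \<sigma>" and f: "f \<in> borel_measurable (coords (Suc n))"
  shows "(\<integral>\<^sup>+x. f x \<partial>gauss_prod (Suc n) \<mu> \<sigma>)
    = (\<integral>\<^sup>+x. \<integral>\<^sup>+y. f (x(Suc n := y)) \<partial>gauss \<mu> \<sigma> \<partial>gauss_prod n \<mu> \<sigma>)"
proof -
  interpret product_prob_space "\<lambda>_::nat. gauss \<mu> \<sigma>" by (rule gauss_product[OF \<sigma>])
  have I: "{1..Suc n} = insert (Suc n) {1..n}" by auto
  have f': "f \<in> borel_measurable (gauss_prod (Suc n) \<mu> \<sigma>)"
    using f unfolding measurable_gauss_prod .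
  show ?thesis
    using product_nn_integral_insert[of "{1..n}" "Suc n" f] f' unfolding I by simp
qed

text \<open>The normalized mean is standard normal and independent of the sum of squared deviations, which is
  distributed like a sum of one square fewer. The induction performs Helmert's orthogonal
  transformation one plane rotation at a time: a new observation \<open>y\<close> and the old normalized mean \<open>a\<close> are
  rotated into the new normalized mean \<open>c a + s y\<close> and an independent standard normal \<open>c y - s a\<close>, whose
  square is exactly what is added to the squared deviations.\<close>

lemma std_gauss_mean_deviation_law:
  fixes f :: "real \<Rightarrow> real \<Rightarrow> ennreal"
  assumes f: "case_prod f \<in> borel_measurable (borel \<Otimes>\<^sub>M borel)"
  shows "(\<integral>\<^sup>+x. f (coord_sum (Suc n) x / sqrt (Suc n)) (sumsq (Suc n) x - (coord_sum (Suc n) x)\<^sup>2 / Suc n) \<partial>gauss_prod (Suc n) 0 1)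
    = (\<integral>\<^sup>+y. \<integral>\<^sup>+a. f a (sumsq n y) \<partial>gauss 0 1 \<partial>gauss_prod n 0 1)"
  using f
proof (induction n arbitrary: f)
  case 0
  note 0[measurable]
  have "(\<lambda>x. f (coord_sum (Suc 0) x / sqrt (Suc 0)) (sumsq (Suc 0) x - (coord_sum (Suc 0) x)\<^sup>2 / Suc 0)) \<in> borel_measurable (coords (Suc 0))"
    by measurable
  then show ?case
    by (subst nn_integral_gauss_prod_Suc) (auto simp: coord_sum_def sumsq_def)
next
  case (Suc n)
  note Suc.prems[measurable]
  let ?G = "gauss 0 1"
  interpret G: prob_space ?G by (rule gauss_prob) simp
  interpret GG: pair_sigma_finite ?G ?G ..
    \<comment> \<open>Cosine and sine of the rotation whose first new coordinate is the new normalized mean.\<close>define c where "c = sqrt (Suc n) / sqrt (Suc (Suc n))"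
  define s where "s = 1 / sqrt (Suc (Suc n))"
  have s: "0 < s" by (simp add: s_def)
  have cs: "c\<^sup>2 + s\<^sup>2 = 1" by (simp add: c_def s_def power_divide field_simps)
  define H where "H = (\<lambda>a v. \<integral>\<^sup>+y. f (c * a + s * y) (v + (c * y - s * a)\<^sup>2) \<partial>?G)"
  have H[measurable]: "case_prod H \<in> borel_measurable (borel \<Otimes>\<^sub>M borel)"
    unfolding H_def by measurable
  have step: "(\<integral>\<^sup>+y. f (coord_sum (Suc (Suc n)) (x(Suc (Suc n) := y)) / sqrt (Suc (Suc n)))
        (sumsq (Suc (Suc n)) (x(Suc (Suc n) := y)) - (coord_sum (Suc (Suc n)) (x(Suc (Suc n) := y)))\<^sup>2 / Suc (Suc n)) \<partial>?G)
     = H (coord_sum (Suc n) x / sqrt (Suc n)) (sumsq (Suc n) x - (coord_sum (Suc n) x)\<^sup>2 / Suc n)" for x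
  proof -
    define S where "S = coord_sum (Suc n) x"
    have 1: "c * (S / sqrt (Suc n)) + s * y = (S + y) / sqrt (Suc (Suc n))" for y
      by (simp add: c_def s_def field_simps)
    have 2: "sumsq (Suc n) x - S\<^sup>2 / Suc n + (c * y - s * (S / sqrt (Suc n)))\<^sup>2
      = sumsq (Suc n) x + y\<^sup>2 - (S + y)\<^sup>2 / Suc (Suc n)" for y
    proof -
      have "(c * A + s * y)\<^sup>2 + (c * y - s * A)\<^sup>2 = (c\<^sup>2 + s\<^sup>2) * (A\<^sup>2 + y\<^sup>2)" for A
        by (simp add: power2_eq_square algebra_simps)
      from this[of "S / sqrt (Suc n)"]
      have "((S + y) / sqrt (Suc (Suc n)))\<^sup>2 + (c * y - s * (S / sqrt (Suc n)))\<^sup>2 = (S / sqrt (Suc n))\<^sup>2 + y\<^sup>2"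
        unfolding 1 cs by simp
      then show ?thesis
        by (simp add: power_divide)
    qed
    have upd: "coord_sum (Suc (Suc n)) (x(Suc (Suc n) := y)) = S + y"
      "sumsq (Suc (Suc n)) (x(Suc (Suc n) := y)) = sumsq (Suc n) x + y\<^sup>2" for y
      by (simp_all add: coord_sum_Suc[of "Suc n"] sumsq_Suc[of "Suc n"] coord_sum_upd sumsq_upd S_def)
    show ?thesis unfolding H_def S_def[symmetric] upd 1 2 ..
  qed
  have m: "(\<lambda>x. f (coord_sum (Suc (Suc n)) x / sqrt (Suc (Suc n))) (sumsq (Suc (Suc n)) x - (coord_sum (Suc (Suc n)) x)\<^sup>2 / Suc (Suc n))) \<in> borel_measurable (coords (Suc (Suc n)))"
    by measurable
  have "(\<integral>\<^sup>+x. f (coord_sum (Suc (Suc n)) x / sqrt (Suc (Suc n))) (sumsq (Suc (Suc n)) x - (coord_sum (Suc (Suc n)) x)\<^sup>2 / Suc (Suc n)) \<partial>gauss_prod (Suc (Suc n)) 0 1)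
     = (\<integral>\<^sup>+x. H (coord_sum (Suc n) x / sqrt (Suc n)) (sumsq (Suc n) x - (coord_sum (Suc n) x)\<^sup>2 / Suc n) \<partial>gauss_prod (Suc n) 0 1)"
    by (subst nn_integral_gauss_prod_Suc[OF _ m]) (simp_all only: step zero_less_one)
  also have "\<dots> = (\<integral>\<^sup>+z. \<integral>\<^sup>+a. H a (sumsq n z) \<partial>?G \<partial>gauss_prod n 0 1)"
    by (rule Suc.IH[OF H])
  also have "\<dots> = (\<integral>\<^sup>+z. \<integral>\<^sup>+a. \<integral>\<^sup>+b. f a (sumsq n z + b\<^sup>2) \<partial>?G \<partial>?G \<partial>gauss_prod n 0 1)"
    unfolding H_def by (intro nn_integral_cong std_gauss_rotation[OF cs s]) measurable
  also have "\<dots> = (\<integral>\<^sup>+z. \<integral>\<^sup>+b. \<integral>\<^sup>+a. f a (sumsq n z + b\<^sup>2) \<partial>?G \<partial>?G \<partial>gauss_prod n 0 1)"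
    by (intro nn_integral_cong GG.Fubini') measurable
  also have "\<dots> = (\<integral>\<^sup>+y. \<integral>\<^sup>+a. f a (sumsq (Suc n) y) \<partial>?G \<partial>gauss_prod (Suc n) 0 1)"
  proof (subst nn_integral_gauss_prod_Suc)
    show "(\<lambda>y. \<integral>\<^sup>+a. f a (sumsq (Suc n) y) \<partial>?G) \<in> borel_measurable (coords (Suc n))"
      by measurable
  qed (simp_all add: sumsq_Suc sumsq_upd)
  finally show ?case .
qed

text \<open>Substituting \<open>a = t sqrt (q / m)\<close> and integrating out \<open>q\<close> first leaves a Gamma integral with rate
  \<open>(1 + t\<^sup>2 / m) / 2\<close>, which is the Student density. The extended-real quotient matches the one in the
  definition of the \<open>t\<close>-statistic; it differs from the real quotient on the null event \<open>q = 0\<close> only.\<close>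

lemma chi_square_mixture_is_student_t:
  assumes m: "0 < m"
  shows "(\<integral>\<^sup>+y. \<integral>\<^sup>+a. indicator {ereal c<..} (ereal a / ereal (sqrt (sumsq m y / m))) \<partial>gauss 0 1 \<partial>gauss_prod m 0 1)
    = emeasure (student_t m) {c<..}"
proof -
  interpret G: prob_space "gauss 0 1" by (rule gauss_prob) simp
  define p where "p = real m / 2"
  have p: "0 < p" using m by (simp add: p_def)
  define K where "K = 1 / (2 powr p * Gamma p)"
  have K: "0 < K" using Gamma_real_pos[OF p] by (simp add: K_def)
  let ?w = "\<lambda>q. indicator {0<..} q * ennreal (q powr (p - 1) * exp (- (1/2) * q))"
  let ?n = "\<lambda>x. ennreal (normal_density 0 1 x)"
  have inner: "(\<integral>\<^sup>+a. indicator {ereal c<..} (ereal a / ereal (sqrt (q / m))) \<partial>gauss 0 1)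
    = (\<integral>\<^sup>+t. indicator {c<..} t * ennreal (sqrt (q / m) * normal_density 0 1 (sqrt (q / m) * t)) \<partial>lborel)" if q: "0 < q" for q
  proof -
    have pos: "0 < sqrt (q / m)" using q m by simp
    have "(\<integral>\<^sup>+a. indicator {ereal c<..} (ereal a / ereal (sqrt (q / m))) \<partial>gauss 0 1)
       = (\<integral>\<^sup>+a. indicator {c<..} (a / sqrt (q / m)) \<partial>gauss 0 1)"
      using q m by (intro nn_integral_cong) (simp add: indicator_def)
    also have "\<dots> = (\<integral>\<^sup>+a. ?n a * indicator {c<..} (a / sqrt (q / m)) \<partial>lborel)"
      by (rule nn_integral_gauss) measurable
    also have "\<dots> = ennreal \<bar>sqrt (q / m)\<bar> * (\<integral>\<^sup>+t. ?n (0 + sqrt (q / m) * t) * indicator {c<..} ((0 + sqrt (q / m) * t) / sqrt (q / m)) \<partial>lborel)"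
      using pos m by (intro nn_integral_real_affine) auto
    also have "\<dots> = (\<integral>\<^sup>+t. ennreal (sqrt (q / m)) * (?n (0 + sqrt (q / m) * t) * indicator {c<..} ((0 + sqrt (q / m) * t) / sqrt (q / m))) \<partial>lborel)"
      using pos by (subst nn_integral_cmult) auto
    also have "\<dots> = (\<integral>\<^sup>+t. indicator {c<..} t * ennreal (sqrt (q / m) * normal_density 0 1 (sqrt (q / m) * t)) \<partial>lborel)"
      using pos m by (intro nn_integral_cong) (simp add: ennreal_mult' ac_simps)
    finally show ?thesis .
  qed
  have mix: "(\<integral>\<^sup>+q. ennreal K * (?w q * (indicator {c<..} t * ennreal (sqrt (q / m) * normal_density 0 1 (sqrt (q / m) * t)))) \<partial>lborel)
     = ennreal (student_t_density m t) * indicator {c<..} t" for t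
  proof -
    define b where "b = (1 + t\<^sup>2 / m) / 2"
    have b: "0 < b" using m by (simp add: b_def add_pos_nonneg)
    have eq: "ennreal K * (?w q * (indicator {c<..} t * ennreal (sqrt (q / m) * normal_density 0 1 (sqrt (q / m) * t))))
       = (ennreal (K / sqrt (2 * pi * m)) * indicator {c<..} t) * (indicator {0<..} q * ennreal (q powr (p + 1/2 - 1) * exp (- b * q)))" for q
    proof (cases "0 < q")
      case True
      have "sqrt (q / m) * normal_density 0 1 (sqrt (q / m) * t) = 1 / sqrt (2 * pi * m) * (q powr (1/2) * exp (- (t\<^sup>2 / m / 2) * q))"
        using True m by (simp add: normal_density_def power_mult_distrib real_sqrt_mult real_sqrt_divide powr_half_sqrt field_simps)
      moreover have "q powr (p - 1) * exp (- (1/2) * q) * (q powr (1/2) * exp (- (t\<^sup>2 / m / 2) * q)) = q powr (p + 1/2 - 1) * exp (- b * q)"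
      proof -
        have e: "exp (- (1/2) * q) * exp (- (t\<^sup>2 / m / 2) * q) = exp (- b * q)"
          by (subst exp_add[symmetric], rule arg_cong[of _ _ exp]) (simp add: b_def field_simps)
        have pw: "q powr (p - 1) * q powr (1/2) = q powr (p + 1/2 - 1)"
          by (subst powr_add[symmetric], rule arg_cong[of _ _ "\<lambda>z. q powr z"]) simp
        have "q powr (p - 1) * exp (- (1/2) * q) * (q powr (1/2) * exp (- (t\<^sup>2 / m / 2) * q))
          = (q powr (p - 1) * q powr (1/2)) * (exp (- (1/2) * q) * exp (- (t\<^sup>2 / m / 2) * q))"
          by (simp only: ac_simps)
        then show ?thesis unfolding e pw .
      qed
      ultimately have "K * (q powr (p - 1) * exp (- (1/2) * q) * (sqrt (q / m) * normal_density 0 1 (sqrt (q / m) * t)))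
        = K / sqrt (2 * pi * m) * (q powr (p + 1/2 - 1) * exp (- b * q))"
        by (simp add: field_simps)
      then have "ennreal K * (ennreal (q powr (p - 1) * exp (- (1/2) * q)) * ennreal (sqrt (q / m) * normal_density 0 1 (sqrt (q / m) * t)))
        = ennreal (K / sqrt (2 * pi * m)) * ennreal (q powr (p + 1/2 - 1) * exp (- b * q))"
        using True K by (simp add: ennreal_mult'[symmetric])
      then show ?thesis using True by (simp add: indicator_def)
    qed simp
    have "(\<integral>\<^sup>+q. ennreal K * (?w q * (indicator {c<..} t * ennreal (sqrt (q / m) * normal_density 0 1 (sqrt (q / m) * t)))) \<partial>lborel)
      = (ennreal (K / sqrt (2 * pi * m)) * indicator {c<..} t) * ennreal (Gamma (p + 1/2) / b powr (p + 1/2))"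
      unfolding eq using p b by (subst nn_integral_cmult) (simp, subst nn_integral_powr_exp, auto)
    also have "\<dots> = ennreal (K / sqrt (2 * pi * m) * (Gamma (p + 1/2) / b powr (p + 1/2))) * indicator {c<..} t"
      using K by (subst ennreal_mult') (auto simp: ac_simps)
    also have "K / sqrt (2 * pi * m) * (Gamma (p + 1/2) / b powr (p + 1/2)) = student_t_density m t"
    proof -
      define u where "u = (1 + t\<^sup>2 / m) powr (p + 1/2)"
      have "b powr (p + 1/2) = u / (2 powr p * sqrt 2)"
        using m unfolding b_def u_def by (simp add: powr_divide powr_add powr_half_sqrt add_nonneg_nonneg)
      moreover have "student_t_density m t = Gamma (p + 1/2) / (sqrt (m * pi) * Gamma p) * (1 / u)"
      proof -
        have "(real m + 1) / 2 = p + 1/2" "- (real m + 1) / 2 = - (p + 1/2)" "real m / 2 = p"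
          by (simp_all add: p_def field_simps)
        then show ?thesis
          unfolding student_t_density_def u_def by (simp only: powr_minus_divide)
      qed
      ultimately show ?thesis
        unfolding K_def by (simp add: real_sqrt_mult)
    qed
    finally show ?thesis .
  qed
  have "(\<integral>\<^sup>+y. \<integral>\<^sup>+a. indicator {ereal c<..} (ereal a / ereal (sqrt (sumsq m y / m))) \<partial>gauss 0 1 \<partial>gauss_prod m 0 1)
    = ennreal K * (\<integral>\<^sup>+q. ?w q * (\<integral>\<^sup>+a. indicator {ereal c<..} (ereal a / ereal (sqrt (q / m))) \<partial>gauss 0 1) \<partial>lborel)"
    unfolding K_def p_def by (rule std_gauss_sumsq_chi_square_law[OF m]) measurable
  also have "(\<integral>\<^sup>+q. ?w q * (\<integral>\<^sup>+a. indicator {ereal c<..} (ereal a / ereal (sqrt (q / m))) \<partial>gauss 0 1) \<partial>lborel)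
    = (\<integral>\<^sup>+q. ?w q * (\<integral>\<^sup>+t. indicator {c<..} t * ennreal (sqrt (q / m) * normal_density 0 1 (sqrt (q / m) * t)) \<partial>lborel) \<partial>lborel)"
    using inner by (intro nn_integral_cong) (auto simp: indicator_def)
  also have "ennreal K * \<dots>
    = (\<integral>\<^sup>+q. \<integral>\<^sup>+t. ennreal K * (?w q * (indicator {c<..} t * ennreal (sqrt (q / m) * normal_density 0 1 (sqrt (q / m) * t)))) \<partial>lborel \<partial>lborel)"
    by (simp add: nn_integral_cmult)
  also have "\<dots> = (\<integral>\<^sup>+t. \<integral>\<^sup>+q. ennreal K * (?w q * (indicator {c<..} t * ennreal (sqrt (q / m) * normal_density 0 1 (sqrt (q / m) * t)))) \<partial>lborel \<partial>lborel)"
    by (intro lborel_pair.Fubini') measurable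
  also have "\<dots> = (\<integral>\<^sup>+t. ennreal (student_t_density m t) * indicator {c<..} t \<partial>lborel)"
    unfolding mix ..
  also have "\<dots> = emeasure (student_t m) {c<..}"
    unfolding student_t_def by (subst emeasure_density) (auto simp: student_t_density_def)
  finally show ?thesis .
qed

section \<open>The t-statistic and its filtration\<close>

definition obs :: "(nat \<Rightarrow> 'a \<Rightarrow> real) \<Rightarrow> nat \<Rightarrow> 'a \<Rightarrow> nat \<Rightarrow> real" where
  "obs X n \<omega> = (\<lambda>i\<in>{1..n}. X i \<omega>)"

definition ratio :: "nat \<Rightarrow> (nat \<Rightarrow> real) \<Rightarrow> real" where
  "ratio n x = coord_sum n x / sqrt (sumsq n x)"

text \<open>Updates \<open>r = S\<^sub>n / sqrt Q\<^sub>n\<close> when \<open>v\<close> is the pair of \<open>Q\<^sub>n\<close> and the next observation \<open>x\<close>. Keeping \<open>Q\<^sub>n\<close>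
  rather than only \<open>x / sqrt Q\<^sub>n\<close> makes the formula correct for \<open>n = 0\<close> too, where it gives the sign of \<open>x\<close>.\<close>

definition ratio_step :: "real \<Rightarrow> real \<times> real \<Rightarrow> real" where
  "ratio_step r v = (r * sqrt (fst v) + snd v) / sqrt (fst v + (snd v)\<^sup>2)"

text \<open>Turns the value of the \<open>t\<close>-statistic into \<open>S\<^sub>n / sqrt Q\<^sub>n\<close>. The latter lies between \<open>- sqrt n\<close> and \<open>sqrt n\<close>,
  and the end points belong to samples with vanishing variance and nonzero mean.\<close>

definition t_to_ratio :: "nat \<Rightarrow> ereal \<Rightarrow> real" where
  "t_to_ratio n t = (if t = \<infinity> then sqrt n else if t = -\<infinity> then - sqrt n
     else real_of_ereal t * sqrt n / sqrt (real n - 1 + (real_of_ereal t)\<^sup>2))"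

lemma ratio_measurable [measurable]: "ratio n \<in> borel_measurable (coords n)"
  unfolding ratio_def by measurable

lemma ratio_step_measurable [measurable]:
  "case_prod ratio_step \<in> borel_measurable (borel \<Otimes>\<^sub>M (borel \<Otimes>\<^sub>M borel))"
  unfolding ratio_step_def case_prod_beta by measurable

lemma t_to_ratio_measurable [measurable]: "t_to_ratio n \<in> borel_measurable borel"
  unfolding t_to_ratio_def by measurable

lemma coord_sum_obs: "n \<le> k \<Longrightarrow> coord_sum n (obs X k \<omega>) = coord_sum n (\<lambda>i. X i \<omega>)"
  unfolding coord_sum_def obs_def by (intro sum.cong) auto

lemma sumsq_obs: "n \<le> k \<Longrightarrow> sumsq n (obs X k \<omega>) = sumsq n (\<lambda>i. X i \<omega>)"
  unfolding sumsq_def obs_def by (intro sum.cong) auto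

lemma sumsq_0_coord_sum: "sumsq n x = 0 \<Longrightarrow> coord_sum n x = 0"
  unfolding sumsq_def coord_sum_def by (subst (asm) sum_nonneg_eq_0_iff) auto

text \<open>Also true when all coordinates vanish and the ratio is \<open>0 / 0 = 0\<close>.\<close>

lemma ratio_times_norm: "ratio n x * sqrt (sumsq n x) = coord_sum n x"
  using sumsq_0_coord_sum[of n x] by (auto simp: ratio_def)

lemma ratio_Suc: "ratio (Suc n) x = ratio_step (ratio n x) (sumsq n x, x (Suc n))"
  unfolding ratio_step_def fst_conv snd_conv ratio_times_norm
  by (simp add: ratio_def coord_sum_Suc sumsq_Suc)

lemma ratio_step_mono: "0 \<le> fst v \<Longrightarrow> r \<le> r' \<Longrightarrow> ratio_step r v \<le> ratio_step r' v"
  unfolding ratio_step_def by (intro divide_right_mono add_mono mult_right_mono) auto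

lemma sum_sq_dev:
  assumes "1 \<le> n"
  shows "(\<Sum>i=1..n. (x i - coord_sum n x / n)\<^sup>2) = sumsq n x - (coord_sum n x)\<^sup>2 / n"
proof -
  define a where "a = coord_sum n x / n"
  have "(\<Sum>i=1..n. (x i - a)\<^sup>2) = sumsq n x - 2 * a * coord_sum n x + n * a\<^sup>2"
    by (simp add: power2_diff sum.distrib sum_subtractf sumsq_def coord_sum_def sum_distrib_left ac_simps)
  then show ?thesis
    unfolding a_def using assms by (simp add: power2_eq_square field_simps)
qed

text \<open>One formula also covers \<open>n = 1\<close>: there both the numerator and the denominator of the sample variance
  are \<open>0\<close>, and dividing by \<open>0\<close> in the extended reals yields \<open>-\<infinity>\<close>, \<open>0\<close> or \<open>\<infinity>\<close> according to the sign of the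
  observation.\<close>

lemma t_stat_eq:
  assumes "1 \<le> n"
  shows "t_stat X n \<omega> = ereal (coord_sum n (\<lambda>i. X i \<omega>) / sqrt n) /
    ereal (sqrt ((sumsq n (\<lambda>i. X i \<omega>) - (coord_sum n (\<lambda>i. X i \<omega>))\<^sup>2 / n) / (real n - 1)))"
proof (cases "n = 1")
  case True
  then show ?thesis
    by (cases "X 1 \<omega>" "0::real" rule: linorder_cases)
       (simp_all add: t_stat_def coord_sum_def divide_ereal_def zero_ereal_def[symmetric] one_ereal_def[symmetric])
next
  case False
  then show ?thesis
    using sum_sq_dev[OF assms, of "\<lambda>i. X i \<omega>"]
    by (simp add: t_stat_def sample_var_def sample_mean_def coord_sum_def[symmetric])
qed

lemma sumsq_ge: "1 \<le> n \<Longrightarrow> (coord_sum n x)\<^sup>2 / n \<le> sumsq n x"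
  using sum_sq_dev[of n x] by (smt (verit) sum_nonneg zero_le_power2)

lemma t_to_ratio_t_stat:
  assumes n: "1 \<le> n"
  shows "t_to_ratio n (t_stat X n \<omega>) = ratio n (\<lambda>i. X i \<omega>)"
proof -
  define S Q where "S = coord_sum n (\<lambda>i. X i \<omega>)" and "Q = sumsq n (\<lambda>i. X i \<omega>)"
  define v where "v = (Q - S\<^sup>2 / n) / (real n - 1)"
  have Q: "S\<^sup>2 / n \<le> Q" unfolding S_def Q_def by (rule sumsq_ge[OF n])
  have v0: "0 \<le> v" using Q n by (simp add: v_def)
  have T: "t_stat X n \<omega> = ereal (S / sqrt n) / ereal (sqrt v)"
    unfolding t_stat_eq[OF n] S_def Q_def v_def ..
  have R: "ratio n (\<lambda>i. X i \<omega>) = S / sqrt Q" by (simp add: ratio_def S_def Q_def)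
  show ?thesis
  proof (cases "v = 0")
    case True
    have QS: "Q = S\<^sup>2 / n"
    proof (cases "n = 1")
      case True then show ?thesis by (simp add: Q_def S_def sumsq_def coord_sum_def)
    next
      case False then show ?thesis using True n by (simp add: v_def)
    qed
    have "S / sqrt Q = S / \<bar>S\<bar> * sqrt n"
      unfolding QS using n by (simp add: real_sqrt_divide)
    then show ?thesis
      unfolding T R using True n
      by (cases S "0::real" rule: linorder_cases)
         (auto simp: t_to_ratio_def divide_ereal_def zero_ereal_def[symmetric] zero_less_divide_iff divide_less_0_iff)
  next
    case False
    then have v: "0 < v" using v0 by simp
    have "n \<noteq> 1" using False by (auto simp: v_def)
    then have n2: "1 < real n" using n by simp
    have T': "t_stat X n \<omega> = ereal (S / sqrt n / sqrt v)"
      unfolding T using v by simp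
    have "real n - 1 + (S / sqrt n / sqrt v)\<^sup>2 = Q / v"
    proof -
      have "(real n - 1) * v = Q - S\<^sup>2 / n" using n2 by (simp add: v_def)
      then have "(real n - 1 + S\<^sup>2 / n / v) * v = Q" using v by (simp add: distrib_right)
      then have "real n - 1 + S\<^sup>2 / n / v = Q / v" using v by (simp add: eq_divide_eq)
      then show ?thesis using v n2 by (simp add: power_divide power_mult_distrib)
    qed
    then show ?thesis
      unfolding T' R t_to_ratio_def using v n2 by (simp add: real_sqrt_divide)
  qed
qed

lemma t_to_ratio_less_iff:
  assumes n: "2 \<le> n"
  shows "ereal c < t \<longleftrightarrow> t_to_ratio n (ereal c) < t_to_ratio n t"
proof -
  define m where "m = real n - 1"
  have m: "1 \<le> m" using n by (simp add: m_def)
  define g where "g = (\<lambda>r. r / sqrt (m + r\<^sup>2))"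
  have pos: "0 < m + r\<^sup>2" for r using m by (simp add: add_pos_nonneg)
  have bound: "\<bar>g r\<bar> < 1" for r
  proof -
    have "\<bar>r\<bar> = sqrt (r\<^sup>2)" by simp
    also have "\<dots> < sqrt (m + r\<^sup>2)"
      by (rule real_sqrt_less_mono) (use m in simp)
    finally show ?thesis using pos[of r] by (simp add: g_def)
  qed
  have mono: "g a < g b" if ab: "a < b" for a b
  proof -
    have key: "x / sqrt (m + x\<^sup>2) < y / sqrt (m + y\<^sup>2)" if "0 \<le> x" "x < y" for x y
    proof -
      have "x\<^sup>2 < y\<^sup>2" using that by (intro power_strict_mono) auto
      then have "m * x\<^sup>2 < m * y\<^sup>2" using m by simp
      then have "x\<^sup>2 / (m + x\<^sup>2) < y\<^sup>2 / (m + y\<^sup>2)"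
        using pos[of x] pos[of y] by (simp add: divide_less_eq less_divide_eq algebra_simps)
      then have "(x / sqrt (m + x\<^sup>2))\<^sup>2 < (y / sqrt (m + y\<^sup>2))\<^sup>2"
        using pos[of x] pos[of y] by (simp add: power_divide)
      then show ?thesis
        by (rule power2_less_imp_less) (use that pos[of y] in simp)
    qed
    show ?thesis
    proof (cases "0 \<le> a")
      case True then show ?thesis using key[OF True ab] by (simp add: g_def)
    next
      case a: False
      show ?thesis
      proof (cases "b \<le> 0")
        case True then show ?thesis using key[of "-b" "-a"] ab by (simp add: g_def)
      next
        case False
        have "g a < 0" using a pos[of a] by (simp add: g_def divide_neg_pos)
        moreover have "0 < g b" using False pos[of b] by (simp add: g_def)
        ultimately show ?thesis by simp
      qed
    qed
  qed
  have sn: "0 < sqrt n" using n by simp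
  have real: "t_to_ratio n (ereal r) = sqrt n * g r" for r
    by (simp add: t_to_ratio_def g_def m_def)
  show ?thesis
  proof (cases t)
    case (real r)
    have "c < r \<longleftrightarrow> g c < g r" using mono[of c r] mono[of r c] by (cases c r rule: linorder_cases) auto
    then show ?thesis unfolding real \<open>\<And>r. t_to_ratio n (ereal r) = sqrt n * g r\<close> using sn by simp
  next
    case PInf
    have "sqrt n * g c < sqrt n * 1" using bound[of c] sn by (intro mult_strict_left_mono) auto
    then show ?thesis unfolding PInf real by (simp add: t_to_ratio_def)
  next
    case MInf
    have "sqrt n * - 1 < sqrt n * g c" using bound[of c] sn by (intro mult_strict_left_mono) auto
    then show ?thesis unfolding MInf real by (simp add: t_to_ratio_def)
  qed
qed

lemma t_stat_dilate:
  assumes a: "0 < a" and k: "1 \<le> k" "k \<le> n"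
  shows "t_stat (\<lambda>i x. x i) k (dilate n a x) = t_stat (\<lambda>i x. x i) k x"
proof -
  have S: "coord_sum k (dilate n a x) = a * coord_sum k x"
    using k unfolding coord_sum_def dilate_def sum_distrib_left by (intro sum.cong) auto
  have Q: "sumsq k (dilate n a x) = a\<^sup>2 * sumsq k x"
    using k unfolding sumsq_def dilate_def sum_distrib_left by (intro sum.cong) (auto simp: power_mult_distrib)
  define v where "v = (sumsq k x - (coord_sum k x)\<^sup>2 / k) / (real k - 1)"
  have "sqrt ((a\<^sup>2 * sumsq k x - (a * coord_sum k x)\<^sup>2 / k) / (real k - 1)) = sqrt (a\<^sup>2 * v)"
    by (simp add: v_def power_mult_distrib algebra_simps)
  also have "\<dots> = a * sqrt v" using a by (simp add: real_sqrt_mult)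
  finally have V: "sqrt ((a\<^sup>2 * sumsq k x - (a * coord_sum k x)\<^sup>2 / k) / (real k - 1)) = a * sqrt v" .
  have "ereal (a * s) / ereal (a * w) = ereal s / ereal w" for s w
    using a by (cases "w = 0"; cases s "0::real" rule: linorder_cases)
      (auto simp: divide_ereal_def zero_ereal_def[symmetric] zero_less_mult_iff mult_less_0_iff)
  then show ?thesis
    unfolding t_stat_eq[OF k(1)] S Q V v_def[symmetric] times_divide_eq_right[symmetric] .
qed

text \<open>Reads the \<open>t\<close>-statistic as a function on the coordinate space, so that its invariance under dilations
  can be expressed.\<close>

lemma t_stat_obs:
  assumes "1 \<le> k" "k \<le> n"
  shows "t_stat X k \<omega> = t_stat (\<lambda>i x. x i) k (obs X n \<omega>)"
  unfolding t_stat_eq[OF assms(1)] coord_sum_obs[OF assms(2)] sumsq_obs[OF assms(2)] ..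

lemma t_stat_coords_measurable:
  assumes "1 \<le> k" "k \<le> n"
  shows "t_stat (\<lambda>i x. x i) k \<in> borel_measurable (coords n)"
proof -
  have [measurable]: "(\<lambda>x. x i) \<in> borel_measurable (coords n)" if "i \<in> {1..k}" for i
    using that assms by (intro measurable_component_singleton) auto
  show ?thesis
    unfolding t_stat_eq[OF assms(1)] coord_sum_def sumsq_def by measurable
qed

lemma space_t_filtration: "space (t_filtration M X t) = space M"
  unfolding t_filtration_def by (subst space_measure_of) auto

lemma sets_t_filtration: "sets (t_filtration M X t) =
   sigma_sets (space M) {t_stat X k -` A \<inter> space M | k A. 1 \<le> k \<and> enat k \<le> t \<and> A \<in> sets borel}"
  unfolding t_filtration_def by (subst sets_measure_of) auto

lemma t_filtration_mono: "s \<le> t \<Longrightarrow> sets (t_filtration M X s) \<subseteq> sets (t_filtration M X t)"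
  unfolding sets_t_filtration using order_trans by (intro sigma_sets_mono') blast

lemma t_stat_t_filtration_measurable:
  assumes "1 \<le> k" "k \<le> n"
  shows "t_stat X k \<in> borel_measurable (t_filtration M X (enat n))"
proof (rule measurableI)
  fix A :: "ereal set" assume "A \<in> sets borel"
  then show "t_stat X k -` A \<inter> space (t_filtration M X (enat n)) \<in> sets (t_filtration M X (enat n))"
    unfolding space_t_filtration sets_t_filtration using assms
    by (intro sigma_sets.Basic) (blast intro: enat_ord_simps(1)[THEN iffD2])
qed simp

lemma ratio_t_filtration_measurable:
  "(\<lambda>\<omega>. ratio n (\<lambda>i. X i \<omega>)) \<in> borel_measurable (t_filtration M X (enat n))"
proof (cases "n = 0")
  case False
  then have n: "1 \<le> n" by simp
  show ?thesis
    unfolding t_to_ratio_t_stat[OF n, symmetric]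
    using t_stat_t_filtration_measurable[OF n order_refl] by measurable
qed (simp add: ratio_def coord_sum_def)

text \<open>The \<open>t\<close>-statistics do not change when the sample is rescaled, and the preimages of dilation-invariant sets
  form a \<open>\<sigma>\<close>-algebra; so the filtration contains no other events.\<close>

lemma t_filtration_dilation_invariant:
  assumes "A \<in> sets (t_filtration M X (enat n))"
  shows "\<exists>B. dilation_invariant n B \<and> A = {\<omega>\<in>space M. obs X n \<omega> \<in> B}"
  using assms unfolding sets_t_filtration
proof induction
  case (Basic A)
  then obtain k C where k: "1 \<le> k" "k \<le> n" and C: "C \<in> sets borel" and A: "A = t_stat X k -` C \<inter> space M"
    by auto
  have "{x\<in>space (coords n). t_stat (\<lambda>i x. x i) k x \<in> C} \<in> sets (coords n)"
    using t_stat_coords_measurable[OF k] C by measurable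
  then have "dilation_invariant n {x\<in>space (coords n). t_stat (\<lambda>i x. x i) k x \<in> C}"
    using t_stat_dilate[OF _ k] by (auto simp: dilation_invariant_def dilate_def space_PiM)
  moreover have "A = {\<omega>\<in>space M. obs X n \<omega> \<in> {x\<in>space (coords n). t_stat (\<lambda>i x. x i) k x \<in> C}}"
  proof -
    have "t_stat X k \<omega> \<in> C \<longleftrightarrow> t_stat (\<lambda>i x. x i) k (obs X n \<omega>) \<in> C" for \<omega>
      by (subst t_stat_obs[OF k]) (rule refl)
    moreover have "obs X n \<omega> \<in> space (coords n)" for \<omega>
      by (simp add: obs_def space_PiM)
    ultimately show ?thesis unfolding A by blast
  qed
  ultimately show ?case by blast
next
  case Empty
  have "dilation_invariant n {}" by (simp add: dilation_invariant_def)
  then show ?case by (intro exI[of _ "{}"]) auto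
next
  case (Compl A)
  then obtain B where B: "dilation_invariant n B" "A = {\<omega>\<in>space M. obs X n \<omega> \<in> B}" by blast
  have "dilation_invariant n (space (coords n) - B)"
    using B(1) by (auto simp: dilation_invariant_def dilate_def space_PiM)
  moreover have "space M - A = {\<omega>\<in>space M. obs X n \<omega> \<in> space (coords n) - B}"
    using B(2) by (auto simp: obs_def space_PiM)
  ultimately show ?case by blast
next
  case (Union A)
  then have "\<forall>i. \<exists>B. dilation_invariant n B \<and> A i = {\<omega>\<in>space M. obs X n \<omega> \<in> B}" by simp
  from choice[OF this] obtain B where
    B: "\<And>i. dilation_invariant n (B i)" "\<And>i. A i = {\<omega>\<in>space M. obs X n \<omega> \<in> B i}" by blast
  have "dilation_invariant n (\<Union>i::nat. B i)"
    using B(1) by (auto simp: dilation_invariant_def)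
  moreover have "(\<Union>i. A i) = {\<omega>\<in>space M. obs X n \<omega> \<in> (\<Union>i. B i)}"
    using B(2) by auto
  ultimately show ?case by blast
qed

lemma iid_normal_measurable:
  "iid_normal P X \<mu> \<sigma> \<Longrightarrow> 1 \<le> i \<Longrightarrow> X i \<in> borel_measurable P"
  unfolding iid_normal_def distributed_def by simp

lemma obs_measurable:
  assumes "iid_normal P X \<mu> \<sigma>"
  shows "obs X n \<in> P \<rightarrow>\<^sub>M coords n"
  unfolding obs_def using iid_normal_measurable[OF assms] by (intro measurable_restrict) auto

text \<open>For \<open>n \<ge> 1\<close> this is what independence means. For \<open>n = 0\<close> the coordinate space is a single point, which
  carries only one probability measure.\<close>

lemma distr_obs:
  assumes iid: "iid_normal P X \<mu> \<sigma>"
  shows "distr P (coords n) (obs X n) = gauss_prod n \<mu> \<sigma>"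
proof -
  interpret P: prob_space P using iid by (simp add: iid_normal_def)
  have X: "X i \<in> borel_measurable P" if "i \<in> {1..n}" for i
    using iid_normal_measurable[OF iid] that by simp
  have law: "distr P borel (X i) = gauss \<mu> \<sigma>" if "i \<in> {1..n}" for i
  proof -
    have "distr P borel (X i) = distr P lborel (X i)" by (intro distr_cong) auto
    also have "\<dots> = gauss \<mu> \<sigma>"
      using iid that by (intro distributed_distr_eq_density) (auto simp: iid_normal_def)
    finally show ?thesis .
  qed
  show ?thesis
  proof (cases "n = 0")
    case False
    have "P.indep_vars (\<lambda>_. borel) X {1..n}"
      using iid by (intro P.indep_vars_subset[of _ X "{1..}" "{1..n}"]) (auto simp: iid_normal_def)
    then have "distr P (coords n) (obs X n) = (\<Pi>\<^sub>M i\<in>{1..n}. distr P borel (X i))"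
      using False X P.indep_vars_iff_distr_eq_PiM'[where I = "{1..n}" and M' = "\<lambda>_. borel" and X = X] by (simp add: obs_def[abs_def])
    also have "\<dots> = gauss_prod n \<mu> \<sigma>"
      by (intro PiM_cong law) auto
    finally show ?thesis .
  next
    case True
    have "prob_space (distr P (coords n) (obs X n))"
      by (intro P.prob_space_distr obs_measurable[OF iid])
    moreover have "prob_space (gauss_prod n \<mu> \<sigma>)"
      unfolding True by (intro prob_spaceI) (simp add: PiM_empty)
    ultimately have one: "emeasure (distr P (coords n) (obs X n)) (space (coords n)) = 1"
      "emeasure (gauss_prod n \<mu> \<sigma>) (space (coords n)) = 1"
      by (auto dest!: prob_space.emeasure_space_1 simp: sets_eq_imp_space_eq[OF sets_gauss_prod])
    show ?thesis
    proof (rule measure_eqI)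
      show "sets (distr P (coords n) (obs X n)) = sets (gauss_prod n \<mu> \<sigma>)"
        by (simp add: sets_gauss_prod)
      fix A assume "A \<in> sets (distr P (coords n) (obs X n))"
      then have "A = {} \<or> A = space (coords n)"
        unfolding True by (auto simp: sets_PiM_empty space_PiM)
      then show "emeasure (distr P (coords n) (obs X n)) A = emeasure (gauss_prod n \<mu> \<sigma>) A"
        using one by auto
    qed
  qed
qed

lemma nn_integral_obs:
  assumes iid: "iid_normal P X \<mu> \<sigma>" and f: "f \<in> borel_measurable (coords n)"
  shows "(\<integral>\<^sup>+\<omega>. f (obs X n \<omega>) \<partial>P) = (\<integral>\<^sup>+x. f x \<partial>gauss_prod n \<mu> \<sigma>)"
  unfolding distr_obs[OF iid, symmetric] using f obs_measurable[OF iid] by (subst nn_integral_distr) auto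

section \<open>The ratio process as a Markov chain\<close>

text \<open>Two oppositely ordered functions are negatively correlated: integrate
  \<open>f x * g x + f y * g y \<le> f x * g y + f y * g x\<close> over two independent copies. With values in the extended
  nonnegative reals there is no integrability to verify.\<close>

lemma ennreal_chebyshev_association:
  fixes f g :: "'a \<Rightarrow> ennreal"
  assumes "prob_space P" and [measurable]: "f \<in> borel_measurable P" "g \<in> borel_measurable P"
    and opp: "\<And>x y. x \<in> space P \<Longrightarrow> y \<in> space P \<Longrightarrow> f x \<le> f y \<and> g y \<le> g x \<or> f y \<le> f x \<and> g x \<le> g y"
  shows "(\<integral>\<^sup>+x. f x * g x \<partial>P) \<le> (\<integral>\<^sup>+x. f x \<partial>P) * (\<integral>\<^sup>+x. g x \<partial>P)"
proof -
  interpret prob_space P by fact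
  have ord: "a * c + b * d \<le> a * d + b * c" if le: "a \<le> b" "d \<le> c" for a b c d :: ennreal
  proof -
    obtain e where e: "b = a + e" using le(1) unfolding le_iff_add by blast
    obtain k where k: "c = d + k" using le(2) unfolding le_iff_add by blast
    have "a * c + b * d + e * k = a * d + b * c"
      unfolding e k by (simp add: algebra_simps)
    then show ?thesis by (metis le_iff_add)
  qed
  have pt: "f x * g x + f y * g y \<le> f x * g y + f y * g x" if "x \<in> space P" "y \<in> space P" for x y
    using opp[OF that] ord[of "f x" "f y" "g y" "g x"] ord[of "f y" "f x" "g x" "g y"]
    by (auto simp: ac_simps)
  have "2 * (\<integral>\<^sup>+x. f x * g x \<partial>P) = (\<integral>\<^sup>+x. \<integral>\<^sup>+y. f x * g x + f y * g y \<partial>P \<partial>P)"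
    by (simp add: nn_integral_add emeasure_space_1 mult_2)
  also have "\<dots> \<le> (\<integral>\<^sup>+x. \<integral>\<^sup>+y. f x * g y + f y * g x \<partial>P \<partial>P)"
    using pt by (intro nn_integral_mono) auto
  also have "\<dots> = 2 * ((\<integral>\<^sup>+x. f x \<partial>P) * (\<integral>\<^sup>+x. g x \<partial>P))"
    by (simp add: nn_integral_add nn_integral_cmult nn_integral_multc mult_2 mult_2_right distrib_left ac_simps)
  finally show ?thesis
    by (subst (asm) ennreal_mult_le_mult_iff) auto
qed

lemma iid_normal_ratio_sumsq_measurable:
  "iid_normal P X \<mu> \<sigma> \<Longrightarrow> (\<lambda>\<omega>. ratio n (\<lambda>i. X i \<omega>)) \<in> borel_measurable P"
  "iid_normal P X \<mu> \<sigma> \<Longrightarrow> (\<lambda>\<omega>. sumsq n (\<lambda>i. X i \<omega>)) \<in> borel_measurable P"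
  using measurable_compose[OF obs_measurable ratio_measurable, of P X \<mu> \<sigma> n]
    measurable_compose[OF obs_measurable sumsq_measurable, of P X \<mu> \<sigma> n]
  by (simp_all add: ratio_def coord_sum_obs sumsq_obs)

lemma sets_t_filtration_le:
  assumes iid: "iid_normal P X \<mu> \<sigma>" and sets: "sets P = sets M"
  shows "sets (t_filtration M X (enat n)) \<subseteq> sets P"
proof
  fix A assume "A \<in> sets (t_filtration M X (enat n))"
  then obtain B where B: "dilation_invariant n B" "A = {\<omega>\<in>space M. obs X n \<omega> \<in> B}"
    using t_filtration_dilation_invariant by blast
  have "A = obs X n -` B \<inter> space P"
    using B(2) sets_eq_imp_space_eq[OF sets] by auto
  then show "A \<in> sets P"
    using measurable_sets[OF obs_measurable[OF iid]] B(1) by (simp add: dilation_invariant_def)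
qed

lemma subalgebra_t_filtration:
  "iid_normal P X \<mu> \<sigma> \<Longrightarrow> sets P = sets M \<Longrightarrow> subalgebra P (t_filtration M X (enat n))"
  unfolding subalgebra_def space_t_filtration using sets_t_filtration_le sets_eq_imp_space_eq by metis

text \<open>The reference model, under which the conditional expectations defining the sequential test are taken.
  Other laws \<open>P\<close> of the same observations enter the lemmas below as hypotheses.\<close>

locale std_normal_model =
  fixes M P0 :: "'a measure" and X :: "nat \<Rightarrow> 'a \<Rightarrow> real"
  assumes sets_P0: "sets P0 = sets M" and iid: "iid_normal P0 X 0 1"
begin

abbreviation F :: "nat \<Rightarrow> 'a measure" where "F n \<equiv> t_filtration M X (enat n)"

definition R :: "nat \<Rightarrow> 'a \<Rightarrow> real" where "R n \<omega> = ratio n (\<lambda>i. X i \<omega>)"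

definition V :: "nat \<Rightarrow> 'a \<Rightarrow> real \<times> real" where "V n \<omega> = (sumsq n (\<lambda>i. X i \<omega>), X (Suc n) \<omega>)"

sublocale P0: prob_space P0
  using iid by (simp add: iid_normal_def)

lemma space_P0: "space P0 = space M"
  by (rule sets_eq_imp_space_eq[OF sets_P0])

lemma F_measurable_P0: "f \<in> borel_measurable (F n) \<Longrightarrow> f \<in> borel_measurable P0"
  by (rule measurable_from_subalg[OF subalgebra_t_filtration[OF iid sets_P0]])

lemma F_Suc_measurable: "f \<in> borel_measurable (F n) \<Longrightarrow> f \<in> borel_measurable (F (Suc n))"
  using t_filtration_mono[of "enat n" "enat (Suc n)"]
  by (intro measurable_from_subalg[of "F (Suc n)" "F n"]) (auto simp: subalgebra_def space_t_filtration)

lemma R_measurable [measurable]: "R n \<in> borel_measurable (F n)"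
  unfolding R_def by (rule ratio_t_filtration_measurable)

lemma R_measurable_P0 [measurable]: "R n \<in> borel_measurable P0"
  by (rule F_measurable_P0[OF R_measurable])

lemma V_measurable [measurable]: "V n \<in> P0 \<rightarrow>\<^sub>M (borel \<Otimes>\<^sub>M borel)"
  unfolding V_def using iid_normal_ratio_sumsq_measurable(2)[OF iid] iid_normal_measurable[OF iid]
  by (intro measurable_Pair) auto

lemma R_Suc: "R (Suc n) \<omega> = ratio_step (R n \<omega>) (V n \<omega>)"
  unfolding R_def V_def by (rule ratio_Suc)

text \<open>Integrating out the next observation first leaves a function of the squared radius, to which the
  independence of radius and direction applies.\<close>

lemma dilation_invariant_indep_V:
  assumes B: "dilation_invariant n B" and k: "k \<in> borel_measurable (borel \<Otimes>\<^sub>M borel)"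
  shows "(\<integral>\<^sup>+\<omega>. indicator B (obs X n \<omega>) * k (V n \<omega>) \<partial>P0)
    = emeasure (gauss_prod n 0 1) B * (\<integral>\<^sup>+x. \<integral>\<^sup>+y. k (sumsq n x, y) \<partial>gauss 0 1 \<partial>gauss_prod n 0 1)"
proof -
  interpret G: prob_space "gauss 0 1" by (rule gauss_prob) simp
  note k[measurable]
  have [measurable]: "B \<in> sets (coords n)" using B by (simp add: dilation_invariant_def)
    \<comment> \<open>The integrand as a function of the first \<open>n + 1\<close> coordinates.\<close>define g where "g = (\<lambda>x. indicator B (restrict x {1..n}) * k (sumsq n x, x (Suc n)))"
  have [measurable]: "(\<lambda>x. restrict x {1..n}) \<in> coords (Suc n) \<rightarrow>\<^sub>M coords n"
    by (intro measurable_restrict_subset) auto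
  have [measurable]: "sumsq n \<in> borel_measurable (coords (Suc n))"
    unfolding sumsq_def by measurable
  have [measurable]: "(\<lambda>x. x (Suc n)) \<in> borel_measurable (coords (Suc n))"
    by (intro measurable_component_singleton) auto
  have g: "g \<in> borel_measurable (coords (Suc n))"
    unfolding g_def by measurable
  have "(\<integral>\<^sup>+\<omega>. indicator B (obs X n \<omega>) * k (V n \<omega>) \<partial>P0) = (\<integral>\<^sup>+\<omega>. g (obs X (Suc n) \<omega>) \<partial>P0)"
  proof (intro nn_integral_cong)
    fix \<omega>
    have "restrict (obs X (Suc n) \<omega>) {1..n} = obs X n \<omega>"
      by (auto simp: obs_def restrict_def)
    then show "indicator B (obs X n \<omega>) * k (V n \<omega>) = g (obs X (Suc n) \<omega>)"
      by (simp add: g_def V_def sumsq_obs) (simp add: obs_def)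
  qed
  also have "\<dots> = (\<integral>\<^sup>+x. g x \<partial>gauss_prod (Suc n) 0 1)"
    by (rule nn_integral_obs[OF iid g])
  also have "\<dots> = (\<integral>\<^sup>+x. \<integral>\<^sup>+y. g (x(Suc n := y)) \<partial>gauss 0 1 \<partial>gauss_prod n 0 1)"
    by (rule nn_integral_gauss_prod_Suc[OF _ g]) simp
  also have "\<dots> = (\<integral>\<^sup>+x. indicator B x * (\<integral>\<^sup>+y. k (sumsq n x, y) \<partial>gauss 0 1) \<partial>gauss_prod n 0 1)"
  proof (intro nn_integral_cong)
    fix x assume "x \<in> space (gauss_prod n 0 1)"
    then have x: "x \<in> extensional {1..n}" by (simp add: space_PiM PiE_def)
    have "restrict (x(Suc n := y)) {1..n} = x" for y
      using x by (auto simp: restrict_def extensional_def fun_eq_iff)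
    then have "g (x(Suc n := y)) = indicator B x * k (sumsq n x, y)" for y
      by (simp add: g_def sumsq_upd)
    then show "(\<integral>\<^sup>+y. g (x(Suc n := y)) \<partial>gauss 0 1) = indicator B x * (\<integral>\<^sup>+y. k (sumsq n x, y) \<partial>gauss 0 1)"
      by (simp add: nn_integral_cmult)
  qed
  also have "\<dots> = emeasure (gauss_prod n 0 1) B * (\<integral>\<^sup>+x. \<integral>\<^sup>+y. k (sumsq n x, y) \<partial>gauss 0 1 \<partial>gauss_prod n 0 1)"
    by (rule std_gauss_sumsq_indep_dilation_invariant[OF B]) measurable
  finally show ?thesis .
qed

lemma F_indep_V:
  assumes A: "A \<in> sets (F n)" and k: "k \<in> borel_measurable (borel \<Otimes>\<^sub>M borel)"
  shows "(\<integral>\<^sup>+\<omega>. indicator A \<omega> * k (V n \<omega>) \<partial>P0) = emeasure P0 A * (\<integral>\<^sup>+\<omega>. k (V n \<omega>) \<partial>P0)"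
proof -
  interpret G: prob_space "gauss 0 1" by (rule gauss_prob) simp
  interpret GP: prob_space "gauss_prod n 0 1" by (rule gauss_prod_prob) simp
  obtain B where B: "dilation_invariant n B" and AB: "A = {\<omega>\<in>space M. obs X n \<omega> \<in> B}"
    using t_filtration_dilation_invariant[OF A] by blast
  have A': "A \<in> sets P0" using A sets_t_filtration_le[OF iid sets_P0] by blast
  have ind: "(\<integral>\<^sup>+\<omega>. indicator A \<omega> * f \<omega> \<partial>P0) = (\<integral>\<^sup>+\<omega>. indicator B (obs X n \<omega>) * f \<omega> \<partial>P0)" for f :: "'a \<Rightarrow> ennreal"
    by (intro nn_integral_cong) (auto simp: AB indicator_def space_P0)
  have "emeasure P0 A = (\<integral>\<^sup>+\<omega>. indicator A \<omega> * 1 \<partial>P0)"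
    using A' by simp
  also have "\<dots> = emeasure (gauss_prod n 0 1) B"
    unfolding ind by (subst dilation_invariant_indep_V[OF B, of "\<lambda>_. 1"]) (use G.emeasure_space_1 GP.emeasure_space_1 in simp_all)
  finally have 1: "emeasure P0 A = emeasure (gauss_prod n 0 1) B" .
  have "(\<integral>\<^sup>+\<omega>. k (V n \<omega>) \<partial>P0) = (\<integral>\<^sup>+\<omega>. indicator (space (coords n)) (obs X n \<omega>) * k (V n \<omega>) \<partial>P0)"
    by (intro nn_integral_cong) (auto simp: obs_def space_PiM)
  also have "\<dots> = (\<integral>\<^sup>+x. \<integral>\<^sup>+y. k (sumsq n x, y) \<partial>gauss 0 1 \<partial>gauss_prod n 0 1)"
    using GP.emeasure_space_1 sets_eq_imp_space_eq[OF sets_gauss_prod[of n 0 1]]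
    by (subst dilation_invariant_indep_V[OF dilation_invariant_space k]) simp
  finally show ?thesis
    unfolding ind dilation_invariant_indep_V[OF B k] 1 by simp
qed

text \<open>Independence of the past and \<open>V n\<close> in the form needed below: the past may be frozen while an
  independent copy of \<open>V n\<close> is averaged. It is stated through the law of the pair formed by the sample
  point itself, seen in the \<open>n\<close>-th \<open>\<sigma>\<close>-algebra, and \<open>V n\<close>.\<close>

lemma F_V_freeze:
  assumes h: "h \<in> borel_measurable (F n \<Otimes>\<^sub>M (borel \<Otimes>\<^sub>M borel))"
  shows "(\<integral>\<^sup>+\<omega>. h (\<omega>, V n \<omega>) \<partial>P0) = (\<integral>\<^sup>+\<omega>. \<integral>\<^sup>+\<omega>'. h (\<omega>, V n \<omega>') \<partial>P0 \<partial>P0)"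
proof -
  have id[measurable]: "(\<lambda>\<omega>. \<omega>) \<in> P0 \<rightarrow>\<^sub>M F n"
    using sets_t_filtration_le[OF iid sets_P0, of n] sets.sets_into_space
    by (intro measurableI) (auto simp: space_P0 space_t_filtration)
  let ?D = "distr P0 (F n) (\<lambda>\<omega>. \<omega>)" and ?L = "distr P0 (borel \<Otimes>\<^sub>M borel) (V n)"
  interpret D: prob_space ?D by (rule P0.prob_space_distr[OF id])
  interpret L: prob_space ?L by (rule P0.prob_space_distr[OF V_measurable])
  have pair: "?D \<Otimes>\<^sub>M ?L = distr P0 (F n \<Otimes>\<^sub>M (borel \<Otimes>\<^sub>M borel)) (\<lambda>\<omega>. (\<omega>, V n \<omega>))"
  proof (rule pair_measure_eqI)
    show "sets (?D \<Otimes>\<^sub>M ?L) = sets (distr P0 (F n \<Otimes>\<^sub>M (borel \<Otimes>\<^sub>M borel)) (\<lambda>\<omega>. (\<omega>, V n \<omega>)))"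
      by (simp cong: sets_pair_measure_cong)
    fix A C assume "A \<in> sets ?D" "C \<in> sets ?L"
    then have A[measurable]: "A \<in> sets (F n)" and C[measurable]: "C \<in> sets (borel \<Otimes>\<^sub>M borel)" by simp_all
    have A': "A \<in> sets P0" using A sets_t_filtration_le[OF iid sets_P0] by blast
    have "emeasure ?D A = emeasure P0 A"
      using sets.sets_into_space[OF A'] by (subst emeasure_distr) (auto simp: Int_absorb2)
    moreover have "emeasure ?L C = (\<integral>\<^sup>+\<omega>. indicator C (V n \<omega>) \<partial>P0)"
      by (subst nn_integral_distr[symmetric, of "V n" P0 "borel \<Otimes>\<^sub>M borel" "indicator C"]) auto
    moreover have "emeasure (distr P0 (F n \<Otimes>\<^sub>M (borel \<Otimes>\<^sub>M borel)) (\<lambda>\<omega>. (\<omega>, V n \<omega>))) (A \<times> C)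
      = (\<integral>\<^sup>+\<omega>. indicator (A \<times> C) (\<omega>, V n \<omega>) \<partial>P0)"
      by (subst nn_integral_distr[symmetric, of "\<lambda>\<omega>. (\<omega>, V n \<omega>)" P0 "F n \<Otimes>\<^sub>M (borel \<Otimes>\<^sub>M borel)" "indicator (A \<times> C)"]) auto
    moreover have "\<dots> = (\<integral>\<^sup>+\<omega>. indicator A \<omega> * indicator C (V n \<omega>) \<partial>P0)"
      by (simp add: indicator_times)
    ultimately show "emeasure ?D A * emeasure ?L C
      = emeasure (distr P0 (F n \<Otimes>\<^sub>M (borel \<Otimes>\<^sub>M borel)) (\<lambda>\<omega>. (\<omega>, V n \<omega>))) (A \<times> C)"
      using F_indep_V[OF A, of "indicator C"] by simp
  qed (rule D.sigma_finite_measure_axioms L.sigma_finite_measure_axioms)+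
  have h': "h \<in> borel_measurable (?D \<Otimes>\<^sub>M ?L)"
    using h by (simp cong: measurable_cong_sets sets_pair_measure_cong)
  have "(\<integral>\<^sup>+\<omega>. h (\<omega>, V n \<omega>) \<partial>P0) = (\<integral>\<^sup>+z. h z \<partial>(?D \<Otimes>\<^sub>M ?L))"
    unfolding pair using h by (subst nn_integral_distr) auto
  also have "\<dots> = (\<integral>\<^sup>+\<omega>. \<integral>\<^sup>+v. h (\<omega>, v) \<partial>?L \<partial>?D)"
    by (rule L.nn_integral_fst[OF h', symmetric])
  also have "\<dots> = (\<integral>\<^sup>+\<omega>. \<integral>\<^sup>+v. h (\<omega>, v) \<partial>?L \<partial>P0)"
    by (rule nn_integral_distr[OF id]) (use L.borel_measurable_nn_integral_fst[OF h'] in simp)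
  also have "\<dots> = (\<integral>\<^sup>+\<omega>. \<integral>\<^sup>+\<omega>'. h (\<omega>, V n \<omega>') \<partial>P0 \<partial>P0)"
  proof (intro nn_integral_cong)
    fix \<omega> assume "\<omega> \<in> space P0"
    then have "(\<lambda>v. h (\<omega>, v)) \<in> borel_measurable (borel \<Otimes>\<^sub>M borel)"
      using measurable_Pair2[OF h, of \<omega>] by (simp add: space_P0 space_t_filtration)
    then show "(\<integral>\<^sup>+v. h (\<omega>, v) \<partial>?L) = (\<integral>\<^sup>+\<omega>'. h (\<omega>, V n \<omega>') \<partial>P0)"
      by (subst nn_integral_distr) auto
  qed
  finally show ?thesis .
qed

text \<open>The transition operator of the ratio process under the reference model.\<close>

definition ratio_kernel :: "nat \<Rightarrow> (real \<Rightarrow> ennreal) \<Rightarrow> real \<Rightarrow> ennreal" where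
  "ratio_kernel n k r = (\<integral>\<^sup>+\<omega>. k (ratio_step r (V n \<omega>)) \<partial>P0)"

lemma ratio_kernel_measurable [measurable]:
  assumes [measurable]: "k \<in> borel_measurable borel"
  shows "ratio_kernel n k \<in> borel_measurable borel"
  unfolding ratio_kernel_def by measurable

lemma ratio_kernel_mono:
  assumes "mono k"
  shows "mono (ratio_kernel n k)"
  unfolding ratio_kernel_def
  by (intro monoI nn_integral_mono monoD[OF assms] ratio_step_mono) (simp_all add: V_def sumsq_nonneg)

lemma nn_integral_ratio_kernel:
  assumes f[measurable]: "f \<in> borel_measurable (F n)" and k[measurable]: "k \<in> borel_measurable borel"
  shows "(\<integral>\<^sup>+\<omega>. f \<omega> * k (R (Suc n) \<omega>) \<partial>P0) = (\<integral>\<^sup>+\<omega>. f \<omega> * ratio_kernel n k (R n \<omega>) \<partial>P0)"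
proof -
  have "(\<integral>\<^sup>+\<omega>. f \<omega> * k (R (Suc n) \<omega>) \<partial>P0)
     = (\<integral>\<^sup>+\<omega>. \<integral>\<^sup>+\<omega>'. f \<omega> * k (ratio_step (R n \<omega>) (V n \<omega>')) \<partial>P0 \<partial>P0)"
    unfolding R_Suc using F_V_freeze[of "\<lambda>z. f (fst z) * k (ratio_step (R n (fst z)) (snd z))" n] by simp
  also have "\<dots> = (\<integral>\<^sup>+\<omega>. f \<omega> * ratio_kernel n k (R n \<omega>) \<partial>P0)"
    unfolding ratio_kernel_def by (simp add: nn_integral_cmult)
  finally show ?thesis .
qed

text \<open>The density of \<open>N(\<mu>,\<sigma>\<^sup>2)\<close> with respect to \<open>N(0,1)\<close> on the \<open>n\<close>-th \<open>\<sigma>\<close>-algebra at a point where the ratio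
  is \<open>r\<close>, with \<open>\<theta> = \<mu> / \<sigma>\<close>. It is the density ratio of a noncentral to a central \<open>t\<close>-law, written as an
  average over the radius; this form shows its monotonicity in \<open>r\<close> at sight.\<close>

definition ratio_likelihood :: "nat \<Rightarrow> real \<Rightarrow> real \<Rightarrow> ennreal" where
  "ratio_likelihood n \<theta> r = (\<integral>\<^sup>+\<omega>. ennreal (exp (\<theta> * (r * sqrt (fst (V n \<omega>))) - real n * \<theta>\<^sup>2 / 2)) \<partial>P0)"

lemma ratio_likelihood_measurable [measurable]: "ratio_likelihood n \<theta> \<in> borel_measurable borel"
  unfolding ratio_likelihood_def by measurable

lemma ratio_likelihood_antimono: "\<theta> \<le> 0 \<Longrightarrow> r \<le> r' \<Longrightarrow> ratio_likelihood n \<theta> r' \<le> ratio_likelihood n \<theta> r"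
  unfolding ratio_likelihood_def
  by (intro nn_integral_mono ennreal_leI)
    (simp add: mult_left_mono_neg mult_right_mono V_def sumsq_nonneg)

lemma ratio_likelihood_0: "ratio_likelihood 0 \<theta> r = 1"
  by (simp add: ratio_likelihood_def V_def sumsq_def P0.emeasure_space_1)

text \<open>The event is dilation invariant, so rescaling by \<open>\<sigma>\<close> does not change it and the likelihood ratio of
  the full sample becomes \<open>exp (\<theta> S\<^sub>n - n \<theta>\<^sup>2 / 2)\<close>. Writing \<open>S\<^sub>n = R\<^sub>n sqrt Q\<^sub>n\<close>, the radius is independent of
  the event and of \<open>R\<^sub>n\<close> and can be averaged out.\<close>

lemma emeasure_F_change_of_measure:
  assumes P: "iid_normal P X \<mu> \<sigma>" "sets P = sets M" "0 < \<sigma>" and A: "A \<in> sets (F n)"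
  shows "emeasure P A = (\<integral>\<^sup>+\<omega>. indicator A \<omega> * ratio_likelihood n (\<mu> / \<sigma>) (R n \<omega>) \<partial>P0)"
proof -
  let ?\<theta> = "\<mu> / \<sigma>"
  let ?e = "\<lambda>x. exp (?\<theta> * coord_sum n x - real n * ?\<theta>\<^sup>2 / 2)"
  obtain B where B: "dilation_invariant n B" and AB: "A = {\<omega>\<in>space M. obs X n \<omega> \<in> B}"
    using t_filtration_dilation_invariant[OF A] by blast
  have B'[measurable]: "B \<in> sets (coords n)" using B by (simp add: dilation_invariant_def)
  have [measurable]: "B \<in> sets (leb n)" "coord_sum n \<in> borel_measurable (leb n)"
    unfolding sets_leb measurable_leb by measurable
  have AP: "A = obs X n -` B \<inter> space P"
    using AB sets_eq_imp_space_eq[OF P(2)] by auto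
  have "emeasure P A = emeasure (gauss_prod n \<mu> \<sigma>) B"
    unfolding distr_obs[OF P(1), symmetric] AP using obs_measurable[OF P(1)] by (subst emeasure_distr) auto
  also have "\<dots> = (\<integral>\<^sup>+x. ennreal (\<Prod>i\<in>{1..n}. normal_density \<mu> \<sigma> (x i)) * indicator B x \<partial>leb n)"
    unfolding gauss_prod_density[OF P(3)] by (subst emeasure_density) auto
  also have "\<dots> = ennreal (\<sigma> ^ n) * (\<integral>\<^sup>+x. ennreal (\<Prod>i\<in>{1..n}. normal_density \<mu> \<sigma> (dilate n \<sigma> x i)) * indicator B (dilate n \<sigma> x) \<partial>leb n)"
    using P(3) by (intro nn_integral_leb_dilate) measurable
  also have "\<dots> = (\<integral>\<^sup>+x. ennreal (\<sigma> ^ n) * (ennreal (\<Prod>i\<in>{1..n}. normal_density \<mu> \<sigma> (dilate n \<sigma> x i)) * indicator B (dilate n \<sigma> x)) \<partial>leb n)"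
  proof (subst nn_integral_cmult)
    show "(\<lambda>x. ennreal (\<Prod>i\<in>{1..n}. normal_density \<mu> \<sigma> (dilate n \<sigma> x i)) * indicator B (dilate n \<sigma> x)) \<in> borel_measurable (leb n)"
      unfolding measurable_leb by (rule measurable_compose[OF dilate_measurable]) measurable
  qed simp
  also have "\<dots> = (\<integral>\<^sup>+x. ennreal (\<Prod>i\<in>{1..n}. normal_density 0 1 (x i)) * (indicator B x * ennreal (?e x)) \<partial>leb n)"
  proof (intro nn_integral_cong)
    fix x assume "x \<in> space (leb n)"
    then have "x \<in> space (coords n)" by (simp add: space_PiM)
    then have "dilate n \<sigma> x \<in> B \<longleftrightarrow> x \<in> B"
      using B P(3) by (auto simp: dilation_invariant_def)
    then show "ennreal (\<sigma> ^ n) * (ennreal (\<Prod>i\<in>{1..n}. normal_density \<mu> \<sigma> (dilate n \<sigma> x i)) * indicator B (dilate n \<sigma> x))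
       = ennreal (\<Prod>i\<in>{1..n}. normal_density 0 1 (x i)) * (indicator B x * ennreal (?e x))"
      using normal_prod_tilt[OF P(3), of n \<mu> x] P(3)
      by (simp add: indicator_def ennreal_mult'[symmetric] prod_nonneg)
  qed
  also have "\<dots> = (\<integral>\<^sup>+x. indicator B x * ennreal (?e x) \<partial>gauss_prod n 0 1)"
    unfolding gauss_prod_density[of 1, simplified] by (subst nn_integral_density) auto
  also have "\<dots> = (\<integral>\<^sup>+\<omega>. indicator B (obs X n \<omega>) * ennreal (?e (obs X n \<omega>)) \<partial>P0)"
    by (rule nn_integral_obs[OF iid, symmetric]) measurable
  also have "\<dots> = (\<integral>\<^sup>+\<omega>. indicator A \<omega> * ennreal (exp (?\<theta> * (R n \<omega> * sqrt (fst (V n \<omega>))) - real n * ?\<theta>\<^sup>2 / 2)) \<partial>P0)"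
    unfolding R_def V_def fst_conv ratio_times_norm
    by (intro nn_integral_cong) (auto simp: AB indicator_def space_P0 coord_sum_obs)
  also have "\<dots> = (\<integral>\<^sup>+\<omega>. \<integral>\<^sup>+\<omega>'. indicator A \<omega> * ennreal (exp (?\<theta> * (R n \<omega> * sqrt (fst (V n \<omega>'))) - real n * ?\<theta>\<^sup>2 / 2)) \<partial>P0 \<partial>P0)"
    using A F_V_freeze[of "\<lambda>z. indicator A (fst z) * ennreal (exp (?\<theta> * (R n (fst z) * sqrt (fst (snd z))) - real n * ?\<theta>\<^sup>2 / 2))" n]
    by simp
  also have "\<dots> = (\<integral>\<^sup>+\<omega>. indicator A \<omega> * ratio_likelihood n ?\<theta> (R n \<omega>) \<partial>P0)"
    unfolding ratio_likelihood_def by (simp add: nn_integral_cmult)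
  finally show ?thesis .
qed

lemma nn_integral_F_change_of_measure:
  assumes P: "iid_normal P X \<mu> \<sigma>" "sets P = sets M" "0 < \<sigma>" and f: "f \<in> borel_measurable (F n)"
  shows "(\<integral>\<^sup>+\<omega>. f \<omega> \<partial>P) = (\<integral>\<^sup>+\<omega>. f \<omega> * ratio_likelihood n (\<mu> / \<sigma>) (R n \<omega>) \<partial>P0)"
proof -
  let ?L = "\<lambda>\<omega>. ratio_likelihood n (\<mu> / \<sigma>) (R n \<omega>)"
  note sub = subalgebra_t_filtration[OF P(1,2), of n] and sub0 = subalgebra_t_filtration[OF iid sets_P0, of n]
  have L[measurable]: "?L \<in> borel_measurable (F n)" by measurable
  have eq: "restr_to_subalg P (F n) = density (restr_to_subalg P0 (F n)) ?L"
  proof (rule measure_eqI)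
    fix A assume "A \<in> sets (restr_to_subalg P (F n))"
    then have A[measurable]: "A \<in> sets (F n)" using sets_restr_to_subalg[OF sub] by simp
    have A': "A \<in> sets (restr_to_subalg P0 (F n))" using A sets_restr_to_subalg[OF sub0] by simp
    have "emeasure (density (restr_to_subalg P0 (F n)) ?L) A = (\<integral>\<^sup>+\<omega>. ?L \<omega> * indicator A \<omega> \<partial>restr_to_subalg P0 (F n))"
      using A' L measurable_in_subalg[OF sub0 L] by (intro emeasure_density)
    also have "\<dots> = (\<integral>\<^sup>+\<omega>. ?L \<omega> * indicator A \<omega> \<partial>P0)"
      by (intro nn_integral_subalgebra2[OF sub0]) measurable
    also have "\<dots> = emeasure P A"
      unfolding emeasure_F_change_of_measure[OF P A] by (simp add: mult.commute)
    finally show "emeasure (restr_to_subalg P (F n)) A = emeasure (density (restr_to_subalg P0 (F n)) ?L) A"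
      using emeasure_restr_to_subalg[OF sub A] by simp
  qed (use sets_restr_to_subalg[OF sub] sets_restr_to_subalg[OF sub0] in simp)
  have "(\<integral>\<^sup>+\<omega>. f \<omega> \<partial>P) = (\<integral>\<^sup>+\<omega>. f \<omega> \<partial>restr_to_subalg P (F n))"
    by (rule nn_integral_subalgebra2[OF sub f, symmetric])
  also have "\<dots> = (\<integral>\<^sup>+\<omega>. ?L \<omega> * f \<omega> \<partial>restr_to_subalg P0 (F n))"
    unfolding eq using measurable_in_subalg[OF sub0 L] measurable_in_subalg[OF sub0 f] by (rule nn_integral_density)
  also have "\<dots> = (\<integral>\<^sup>+\<omega>. ?L \<omega> * f \<omega> \<partial>P0)"
    using f by (intro nn_integral_subalgebra2[OF sub0]) measurable
  finally show ?thesis by (simp add: mult.commute)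
qed

text \<open>After the change of measure at time \<open>n + 1\<close>, one step of the chain has to average the product of an
  increasing function and the decreasing likelihood. By association this is at most the product of the
  averages, and the average of the likelihood is turned back into a change of measure at time
  \<open>n + 1\<close>, now for an integrand known at time \<open>n\<close>.\<close>

lemma ratio_kernel_supermartingale_step:
  assumes P: "iid_normal P X \<mu> \<sigma>" "sets P = sets M" "0 < \<sigma>" "\<mu> \<le> 0"
    and h: "mono h" and hm[measurable]: "h \<in> borel_measurable borel" and A[measurable]: "A \<in> sets (F n)"
  shows "(\<integral>\<^sup>+\<omega>. indicator A \<omega> * h (R (Suc n) \<omega>) \<partial>P) \<le> (\<integral>\<^sup>+\<omega>. indicator A \<omega> * ratio_kernel n h (R n \<omega>) \<partial>P)"
proof -
  let ?\<theta> = "\<mu> / \<sigma>"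
  let ?L = "ratio_likelihood (Suc n) ?\<theta>"
  have \<theta>: "?\<theta> \<le> 0" using P by (simp add: divide_nonpos_pos)
  have kern_le: "ratio_kernel n (\<lambda>r. h r * ?L r) r \<le> ratio_kernel n h r * ratio_kernel n ?L r" for r
    unfolding ratio_kernel_def
  proof (rule ennreal_chebyshev_association[OF P0.prob_space_axioms])
    fix x y
    let ?u = "ratio_step r (V n x)" and ?v = "ratio_step r (V n y)"
    show "h ?u \<le> h ?v \<and> ?L ?v \<le> ?L ?u \<or> h ?v \<le> h ?u \<and> ?L ?u \<le> ?L ?v"
      using monoD[OF h, of ?u ?v] monoD[OF h, of ?v ?u] ratio_likelihood_antimono[OF \<theta>, of ?u ?v] ratio_likelihood_antimono[OF \<theta>, of ?v ?u]
      by (cases "?u \<le> ?v") auto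
  qed measurable
  have iA: "(indicator A :: 'a \<Rightarrow> ennreal) \<in> borel_measurable (F (Suc n))"
    by (rule F_Suc_measurable) measurable
  have "(\<integral>\<^sup>+\<omega>. indicator A \<omega> * h (R (Suc n) \<omega>) \<partial>P)
     = (\<integral>\<^sup>+\<omega>. indicator A \<omega> * h (R (Suc n) \<omega>) * ?L (R (Suc n) \<omega>) \<partial>P0)"
    by (intro nn_integral_F_change_of_measure[OF P(1-3)] borel_measurable_times_ennreal iA) measurable
  also have "\<dots> = (\<integral>\<^sup>+\<omega>. indicator A \<omega> * ratio_kernel n (\<lambda>r. h r * ?L r) (R n \<omega>) \<partial>P0)"
    using nn_integral_ratio_kernel[of "indicator A" n "\<lambda>r. h r * ?L r"] by (simp add: mult.assoc)
  also have "\<dots> \<le> (\<integral>\<^sup>+\<omega>. (indicator A \<omega> * ratio_kernel n h (R n \<omega>)) * ratio_kernel n ?L (R n \<omega>) \<partial>P0)"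
    unfolding mult.assoc by (intro nn_integral_mono mult_left_mono kern_le) auto
  also have "\<dots> = (\<integral>\<^sup>+\<omega>. (indicator A \<omega> * ratio_kernel n h (R n \<omega>)) * ?L (R (Suc n) \<omega>) \<partial>P0)"
    by (rule nn_integral_ratio_kernel[symmetric]) measurable
  also have "\<dots> = (\<integral>\<^sup>+\<omega>. indicator A \<omega> * ratio_kernel n h (R n \<omega>) \<partial>P)"
    by (rule nn_integral_F_change_of_measure[OF P(1-3), symmetric], rule F_Suc_measurable) measurable
  finally show ?thesis .
qed

text \<open>On each \<open>\<sigma>\<close>-algebra of the filtration every normal model is absolutely continuous with respect to the
  reference model. The versions of the conditional expectations, fixed up to null sets of the
  reference model, are therefore determined under the other models as well.\<close>

lemma AE_F_transfer:
  fixes f g :: "'a \<Rightarrow> 'b :: {second_countable_topology, t2_space}"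
  assumes P: "iid_normal P X \<mu> \<sigma>" "sets P = sets M" "0 < \<sigma>"
    and f[measurable]: "f \<in> borel_measurable (F n)" "g \<in> borel_measurable (F n)"
    and AE: "AE \<omega> in P0. f \<omega> = g \<omega>"
  shows "AE \<omega> in P. f \<omega> = g \<omega>"
proof -
  let ?N = "{\<omega>\<in>space (F n). f \<omega> \<noteq> g \<omega>}"
  have N: "?N \<in> sets (F n)" by measurable
  have sp: "space (F n) = space P" "space (F n) = space P0"
    using sets_eq_imp_space_eq[OF P(2)] by (simp_all add: space_t_filtration space_P0)
  have "emeasure P ?N = (\<integral>\<^sup>+\<omega>. indicator ?N \<omega> * ratio_likelihood n (\<mu> / \<sigma>) (R n \<omega>) \<partial>P0)"
    by (rule emeasure_F_change_of_measure[OF P N])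
  also have "\<dots> = (\<integral>\<^sup>+\<omega>. 0 \<partial>P0)"
    using AE by (intro nn_integral_cong_AE, eventually_elim) (simp add: indicator_def)
  finally have "emeasure P ?N = 0" by simp
  then have "?N \<in> null_sets P"
    using N sets_t_filtration_le[OF P(1,2), of n] by (intro null_setsI) auto
  then show ?thesis
    by (rule AE_I'[of ?N]) (auto simp: sp)
qed


section \<open>The induced sequential test\<close>

lemma t_test_ratio:
  assumes "2 \<le> N"
  shows "t_test X N c \<omega> = indicator {t_to_ratio N (ereal c)<..} (R N \<omega>)"
  unfolding t_test_def R_def using assms t_to_ratio_less_iff[OF assms, of c "t_stat X N \<omega>"] t_to_ratio_t_stat[of N X \<omega>]
  by (auto simp: indicator_def)

lemma t_test_measurable:
  assumes "2 \<le> N"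
  shows "t_test X N c \<in> borel_measurable (F N)"
  unfolding t_test_ratio[OF assms, abs_def] by measurable

text \<open>The statistic is the quotient of the normalized mean and the root of the mean squared deviation; their
  joint law turns the size of the fixed-sample test into a Student tail.\<close>

lemma t_test_level:
  assumes N: "2 \<le> N"
  shows "(\<integral>\<^sup>+\<omega>. ennreal (t_test X N c \<omega>) \<partial>P0) = emeasure (student_t (real N - 1)) {c<..}"
proof -
  obtain m where m: "N = Suc m" "0 < m" using N by (cases N) auto
  define f where "f = (\<lambda>a v. indicator {ereal c<..} (ereal a / ereal (sqrt (v / m))) :: ennreal)"
  have f[measurable]: "case_prod f \<in> borel_measurable (borel \<Otimes>\<^sub>M borel)"
    unfolding f_def by measurable
  let ?g = "\<lambda>x. f (coord_sum (Suc m) x / sqrt (Suc m)) (sumsq (Suc m) x - (coord_sum (Suc m) x)\<^sup>2 / Suc m)"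
  have "(\<integral>\<^sup>+\<omega>. ennreal (t_test X N c \<omega>) \<partial>P0) = (\<integral>\<^sup>+\<omega>. ?g (obs X (Suc m) \<omega>) \<partial>P0)"
    using t_stat_eq[of N X] unfolding m(1)
    by (intro nn_integral_cong) (simp add: t_test_def f_def coord_sum_obs sumsq_obs indicator_def)
  also have "\<dots> = (\<integral>\<^sup>+x. ?g x \<partial>gauss_prod (Suc m) 0 1)"
    by (rule nn_integral_obs[OF iid]) measurable
  also have "\<dots> = (\<integral>\<^sup>+y. \<integral>\<^sup>+a. f a (sumsq m y) \<partial>gauss 0 1 \<partial>gauss_prod m 0 1)"
    by (rule std_gauss_mean_deviation_law[OF f])
  also have "\<dots> = emeasure (student_t (real N - 1)) {c<..}"
    unfolding f_def m(1) using chi_square_mixture_is_student_t[OF m(2), of c] by simp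
  finally show ?thesis .
qed

text \<open>The real conditional expectation is a difference of two extended nonnegative ones. The second vanishes and
  the first is at most \<open>1\<close>, so passing to the extended nonnegative reals loses nothing.\<close>

lemma induced_test_nn_cond_exp:
  assumes ind: "induced_sequential_test P0 (t_filtration M X) (t_test X N c) \<phi>'" and N: "2 \<le> N"
  shows "AE \<omega> in P0. ennreal (\<phi>' n \<omega>) = nn_cond_exp P0 (F n) (\<lambda>\<omega>. ennreal (t_test X N c \<omega>)) \<omega>"
    and "AE \<omega> in P0. 0 \<le> \<phi>' n \<omega>"
proof -
  interpret S: finite_measure_subalgebra P0 "F n"
    by (standard, rule subalgebra_t_filtration[OF iid sets_P0])
  have [measurable]: "t_test X N c \<in> borel_measurable P0"
    by (rule F_measurable_P0[OF t_test_measurable[OF N]])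
  have ae: "AE \<omega> in P0. \<phi>' n \<omega> = real_cond_exp P0 (F n) (t_test X N c) \<omega>"
    using ind by (simp add: induced_sequential_test_def)
  have neg: "(\<lambda>\<omega>. ennreal (- t_test X N c \<omega>)) = (\<lambda>_. 0)"
    by (auto simp: t_test_def indicator_def ennreal_neg)
  have zero: "AE \<omega> in P0. 0 = nn_cond_exp P0 (F n) (\<lambda>_. 0) \<omega>"
    by (rule S.nn_cond_exp_F_meas) simp
  have le: "AE \<omega> in P0. nn_cond_exp P0 (F n) (\<lambda>\<omega>. ennreal (t_test X N c \<omega>)) \<omega> \<le> nn_cond_exp P0 (F n) (\<lambda>_. 1) \<omega>"
    by (rule S.nn_cond_exp_mono, simp add: t_test_def indicator_def) measurable
  have one: "AE \<omega> in P0. 1 = nn_cond_exp P0 (F n) (\<lambda>_. 1) \<omega>"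
    by (rule S.nn_cond_exp_F_meas) simp
  show "AE \<omega> in P0. ennreal (\<phi>' n \<omega>) = nn_cond_exp P0 (F n) (\<lambda>\<omega>. ennreal (t_test X N c \<omega>)) \<omega>"
    using ae zero le one
  proof eventually_elim
    case (elim \<omega>)
    then have "nn_cond_exp P0 (F n) (\<lambda>\<omega>. ennreal (t_test X N c \<omega>)) \<omega> \<noteq> \<top>" by (auto simp: top_unique)
    then show ?case using elim by (simp add: real_cond_exp_def neg less_top)
  qed
  show "AE \<omega> in P0. 0 \<le> \<phi>' n \<omega>"
    using ae zero
    by eventually_elim (simp add: real_cond_exp_def neg)
qed

text \<open>Tower property: the test at time \<open>n\<close> is the conditional expectation of the test at time \<open>n + 1\<close>, and for a
  function of the next ratio this is one application of the transition operator.\<close>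

lemma induced_test_ratio_kernel:
  assumes ind: "induced_sequential_test P0 (t_filtration M X) (t_test X N c) \<phi>'" and N: "2 \<le> N"
    and hm[measurable]: "h \<in> borel_measurable borel"
    and h: "AE \<omega> in P0. ennreal (\<phi>' (Suc n) \<omega>) = h (R (Suc n) \<omega>)"
  shows "AE \<omega> in P0. ennreal (\<phi>' n \<omega>) = ratio_kernel n h (R n \<omega>)"
proof -
  let ?\<phi> = "\<lambda>\<omega>. ennreal (t_test X N c \<omega>)"
  note nn = induced_test_nn_cond_exp(1)[OF ind N]
  have \<phi>: "?\<phi> \<in> borel_measurable P0"
    using F_measurable_P0[OF t_test_measurable[OF N]] by measurable
  interpret S: finite_measure_subalgebra P0 "F n"
    by (standard, rule subalgebra_t_filtration[OF iid sets_P0])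
  interpret S': finite_measure_subalgebra P0 "F (Suc n)"
    by (standard, rule subalgebra_t_filtration[OF iid sets_P0])
  have "AE \<omega> in P0. ratio_kernel n h (R n \<omega>) = nn_cond_exp P0 (F n) ?\<phi> \<omega>"
  proof (rule S.nn_cond_exp_charact[OF _ \<phi>])
    show "(\<lambda>\<omega>. ratio_kernel n h (R n \<omega>)) \<in> borel_measurable (F n)" by measurable
    fix A assume A: "A \<in> sets (F n)"
    have iA: "(indicator A :: 'a \<Rightarrow> ennreal) \<in> borel_measurable (F n)"
      by (rule borel_measurable_indicator[OF A])
    have "(\<integral>\<^sup>+\<omega>. indicator A \<omega> * ?\<phi> \<omega> \<partial>P0) = (\<integral>\<^sup>+\<omega>. indicator A \<omega> * nn_cond_exp P0 (F (Suc n)) ?\<phi> \<omega> \<partial>P0)"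
      by (rule S'.nn_cond_exp_intg[symmetric, OF F_Suc_measurable[OF iA] \<phi>])
    also have "\<dots> = (\<integral>\<^sup>+\<omega>. indicator A \<omega> * h (R (Suc n) \<omega>) \<partial>P0)"
      using nn[of "Suc n"] h by (intro nn_integral_cong_AE, eventually_elim) simp
    also have "\<dots> = (\<integral>\<^sup>+\<omega>. indicator A \<omega> * ratio_kernel n h (R n \<omega>) \<partial>P0)"
      by (rule nn_integral_ratio_kernel[OF iA hm])
    finally show "(\<integral>\<^sup>+\<omega>\<in>A. ?\<phi> \<omega> \<partial>P0) = (\<integral>\<^sup>+\<omega>\<in>A. ratio_kernel n h (R n \<omega>) \<partial>P0)"
      by (simp add: mult.commute)
  qed
  then show ?thesis using nn[of n] by eventually_elim simp
qed

text \<open>Backward induction from the indicator of a half-line at time \<open>N\<close>; the transition operator preserves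
  monotonicity.\<close>

lemma induced_test_mono_ratio:
  assumes ind: "induced_sequential_test P0 (t_filtration M X) (t_test X N c) \<phi>'" and N: "2 \<le> N" and n: "n \<le> N"
  shows "\<exists>h. mono h \<and> h \<in> borel_measurable borel \<and> (AE \<omega> in P0. ennreal (\<phi>' n \<omega>) = h (R n \<omega>))"
  using n
proof (induction n rule: inc_induct)
  case base
  let ?\<phi> = "\<lambda>\<omega>. ennreal (t_test X N c \<omega>)"
  interpret S: finite_measure_subalgebra P0 "F N"
    by (standard, rule subalgebra_t_filtration[OF iid sets_P0])
  define h where "h = (indicator {t_to_ratio N (ereal c)<..} :: real \<Rightarrow> ennreal)"
  have "AE \<omega> in P0. ?\<phi> \<omega> = nn_cond_exp P0 (F N) ?\<phi> \<omega>"
    using t_test_measurable[OF N, of c] by (intro S.nn_cond_exp_F_meas) measurable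
  then have "AE \<omega> in P0. ennreal (\<phi>' N \<omega>) = h (R N \<omega>)"
    using induced_test_nn_cond_exp(1)[OF ind N, of N]
  proof eventually_elim
    case (elim \<omega>)
    have "h (R N \<omega>) = ?\<phi> \<omega>"
      unfolding t_test_ratio[OF N] h_def by (simp add: indicator_def)
    then show ?case using elim by simp
  qed
  moreover have "mono h" "h \<in> borel_measurable borel"
    by (auto simp: h_def mono_def indicator_def)
  ultimately show ?case by blast
next
  case (step n)
  then obtain h where h: "mono h" "h \<in> borel_measurable borel" "AE \<omega> in P0. ennreal (\<phi>' (Suc n) \<omega>) = h (R (Suc n) \<omega>)"
    by blast
  show ?case
    using ratio_kernel_mono[OF h(1)] ratio_kernel_measurable[OF h(2)] induced_test_ratio_kernel[OF ind N h(2,3)] by blast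
qed

lemma induced_test_supermartingale:
  assumes ind: "induced_sequential_test P0 (t_filtration M X) (t_test X N c) \<phi>'" and N: "2 \<le> N" and n: "n < N"
    and P: "iid_normal P X \<mu> \<sigma>" "sets P = sets M" "0 < \<sigma>" "\<mu> \<le> 0" and A[measurable]: "A \<in> sets (F n)"
  shows "(\<integral>\<^sup>+\<omega>. indicator A \<omega> * ennreal (\<phi>' (Suc n) \<omega>) \<partial>P) \<le> (\<integral>\<^sup>+\<omega>. indicator A \<omega> * ennreal (\<phi>' n \<omega>) \<partial>P)"
proof -
  obtain h where h: "mono h" "h \<in> borel_measurable borel"
    "AE \<omega> in P0. ennreal (\<phi>' (Suc n) \<omega>) = h (R (Suc n) \<omega>)"
    using induced_test_mono_ratio[OF ind N, of "Suc n"] n by auto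
  note h4 = induced_test_ratio_kernel[OF ind N h(2,3)]
  note h(2)[measurable]
  have \<phi>'[measurable]: "\<phi>' k \<in> borel_measurable (F k)" for k
    using ind by (simp add: induced_sequential_test_def)
  have tr: "AE \<omega> in P. f \<omega> = g \<omega>" if "f \<in> borel_measurable (F k)" "g \<in> borel_measurable (F k)" "AE \<omega> in P0. f \<omega> = (g \<omega> :: ennreal)" for f g k
    using AE_F_transfer[OF P(1-3) that(1,2,3)] .
  have m1: "(\<lambda>\<omega>. ennreal (\<phi>' (Suc n) \<omega>)) \<in> borel_measurable (F (Suc n))" "(\<lambda>\<omega>. h (R (Suc n) \<omega>)) \<in> borel_measurable (F (Suc n))"
    by measurable
  have m2: "(\<lambda>\<omega>. ennreal (\<phi>' n \<omega>)) \<in> borel_measurable (F n)" "(\<lambda>\<omega>. ratio_kernel n h (R n \<omega>)) \<in> borel_measurable (F n)"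
    by measurable
  have "(\<integral>\<^sup>+\<omega>. indicator A \<omega> * ennreal (\<phi>' (Suc n) \<omega>) \<partial>P) = (\<integral>\<^sup>+\<omega>. indicator A \<omega> * h (R (Suc n) \<omega>) \<partial>P)"
    using tr[OF m1 h(3)] by (intro nn_integral_cong_AE, eventually_elim) simp
  also have "\<dots> \<le> (\<integral>\<^sup>+\<omega>. indicator A \<omega> * ratio_kernel n h (R n \<omega>) \<partial>P)"
    by (rule ratio_kernel_supermartingale_step[OF P h(1,2) A])
  also have "\<dots> = (\<integral>\<^sup>+\<omega>. indicator A \<omega> * ennreal (\<phi>' n \<omega>) \<partial>P)"
    using tr[OF m2 h4] by (intro nn_integral_cong_AE, eventually_elim) simp
  finally show ?thesis .
qed

text \<open>At time \<open>0\<close> the likelihood is \<open>1\<close>, so all models agree there.\<close>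

lemma induced_test_initial:
  assumes ind: "induced_sequential_test P0 (t_filtration M X) (t_test X N c) \<phi>'" and N: "2 \<le> N"
    and P: "iid_normal P X \<mu> \<sigma>" "sets P = sets M" "0 < \<sigma>"
  shows "(\<integral>\<^sup>+\<omega>. ennreal (\<phi>' 0 \<omega>) \<partial>P) = emeasure (student_t (real N - 1)) {c<..}"
proof -
  interpret S: finite_measure_subalgebra P0 "F 0"
    by (standard, rule subalgebra_t_filtration[OF iid sets_P0])
  have \<phi>'[measurable]: "\<phi>' 0 \<in> borel_measurable (F 0)"
    using ind by (simp add: induced_sequential_test_def)
  have [measurable]: "t_test X N c \<in> borel_measurable P0"
    by (rule F_measurable_P0[OF t_test_measurable[OF N]])
  have "(\<integral>\<^sup>+\<omega>. ennreal (\<phi>' 0 \<omega>) \<partial>P) = (\<integral>\<^sup>+\<omega>. ennreal (\<phi>' 0 \<omega>) \<partial>P0)"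
    by (subst nn_integral_F_change_of_measure[OF P, of _ 0]) (measurable, simp add: ratio_likelihood_0)
  also have "\<dots> = (\<integral>\<^sup>+\<omega>. 1 * nn_cond_exp P0 (F 0) (\<lambda>\<omega>. ennreal (t_test X N c \<omega>)) \<omega> \<partial>P0)"
    using induced_test_nn_cond_exp(1)[OF ind N, of 0] by (intro nn_integral_cong_AE) simp
  also have "\<dots> = (\<integral>\<^sup>+\<omega>. 1 * ennreal (t_test X N c \<omega>) \<partial>P0)"
    by (rule S.nn_cond_exp_intg) measurable
  finally show ?thesis by (simp add: t_test_level[OF N])
qed

lemma induced_test_final:
  assumes ind: "induced_sequential_test P0 (t_filtration M X) (t_test X N c) \<phi>'" and N: "2 \<le> N"
    and P: "iid_normal P X \<mu> \<sigma>" "sets P = sets M" "0 < \<sigma>"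
  shows "AE \<omega> in P. \<forall>n\<ge>N. \<phi>' n \<omega> = t_test X N c \<omega>"
proof -
  have "AE \<omega> in P. \<phi>' n \<omega> = t_test X N c \<omega>" if n: "N \<le> n" for n
  proof (rule AE_F_transfer[OF P])
    interpret S: finite_measure_subalgebra P0 "F n"
      by (standard, rule subalgebra_t_filtration[OF iid sets_P0])
    show "\<phi>' n \<in> borel_measurable (F n)"
      using ind by (simp add: induced_sequential_test_def)
    have sub: "subalgebra (F n) (F N)"
      using t_filtration_mono[of "enat N" "enat n"] n by (auto simp: subalgebra_def space_t_filtration)
    show T: "t_test X N c \<in> borel_measurable (F n)"
      by (rule measurable_from_subalg[OF sub t_test_measurable[OF N]])
    have "AE \<omega> in P0. ennreal (t_test X N c \<omega>) = nn_cond_exp P0 (F n) (\<lambda>\<omega>. ennreal (t_test X N c \<omega>)) \<omega>"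
      using T by (intro S.nn_cond_exp_F_meas) measurable
    then show "AE \<omega> in P0. \<phi>' n \<omega> = t_test X N c \<omega>"
      using induced_test_nn_cond_exp[OF ind N, of n]
    proof eventually_elim
      case (elim \<omega>)
      have "0 \<le> t_test X N c \<omega>" by (simp add: t_test_def)
      then show ?case using elim by (simp flip: ennreal_inj)
    qed
  qed
  then show ?thesis by (simp add: AE_all_countable)
qed

text \<open>Let \<open>Y m\<close> be the test stopped at the minimum of \<open>\<tau>\<close> and \<open>m\<close>. Between \<open>m\<close> and \<open>m + 1\<close> only the event that
  \<open>\<tau>\<close> is larger than \<open>m\<close> matters; it is known at time \<open>m\<close>, so the supermartingale inequality applies on it
  and the expectation of \<open>Y m\<close> decreases. Almost surely \<open>Y N\<close> is the stopped test itself, also where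
  \<open>\<tau> = \<infinity>\<close>, since the test is constant from time \<open>N\<close> on.\<close>

lemma stopped_induced_test_le:
  assumes ind: "induced_sequential_test P0 (t_filtration M X) (t_test X N c) \<phi>'" and N: "2 \<le> N"
    and P: "iid_normal P X \<mu> \<sigma>" "sets P = sets M" "0 < \<sigma>" "\<mu> \<le> 0"
    and \<tau>: "stopping_time (t_filtration M X) \<tau>"
  shows "(\<integral>\<^sup>+\<omega>. e2ennreal (stopped_test \<phi>' \<tau> \<omega>) \<partial>P) \<le> emeasure (student_t (real N - 1)) {c<..}"
proof -
  have spP: "space P = space M" by (rule sets_eq_imp_space_eq[OF P(2)])
  have toP: "f \<in> borel_measurable P" if "f \<in> borel_measurable (F n)" for n and f :: "'a \<Rightarrow> ennreal"
    by (rule measurable_from_subalg[OF subalgebra_t_filtration[OF P(1,2)] that])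
  have \<phi>': "\<phi>' k \<in> borel_measurable (F k)" for k
    using ind by (simp add: induced_sequential_test_def)
  have \<phi>P[measurable]: "(\<lambda>\<omega>. ennreal (\<phi>' k \<omega>)) \<in> borel_measurable P" for k
    using \<phi>'[of k] by (intro toP[of _ k]) measurable
  define late where "late m = {\<omega>\<in>space M. enat m \<le> \<tau> \<omega>}" for m
  define stop where "stop m = {\<omega>\<in>space M. \<tau> \<omega> = enat m}" for m
  have late_Suc: "late (Suc m) \<in> sets (F m)" for m
  proof -
    have "late (Suc m) = {\<omega>\<in>space (F m). enat m < \<tau> \<omega>}"
      by (auto simp: late_def space_t_filtration Suc_ile_eq)
    then show ?thesis using stopping_timeD2[OF \<tau>, of "enat m"] by (simp add: pred_def)
  qed
  have late: "late m \<in> sets P" for m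
  proof (cases m)
    case 0
    then show ?thesis by (simp add: late_def zero_enat_def[symmetric] spP[symmetric])
  next
    case (Suc k)
    then show ?thesis using late_Suc[of k] sets_t_filtration_le[OF P(1,2), of k] by blast
  qed
  have stop_eq: "stop m = late m - late (Suc m)" for m
    by (auto simp: stop_def late_def Suc_ile_eq)
  have [measurable]: "late m \<in> sets P" "stop m \<in> sets P" for m
    unfolding stop_eq using late by auto
  have split: "indicator (late m) \<omega> = (indicator (stop m) \<omega> + indicator (late (Suc m)) \<omega> :: ennreal)" for m \<omega>
    by (auto simp: stop_def late_def indicator_def Suc_ile_eq)
  define Y where "Y m \<omega> = (\<Sum>k<m. indicator (stop k) \<omega> * ennreal (\<phi>' k \<omega>)) + indicator (late m) \<omega> * ennreal (\<phi>' m \<omega>)" for m \<omega>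
  have dec: "(\<integral>\<^sup>+\<omega>. Y (Suc m) \<omega> \<partial>P) \<le> (\<integral>\<^sup>+\<omega>. Y m \<omega> \<partial>P)" if m: "m < N" for m
  proof -
    let ?Z = "\<lambda>\<omega>. (\<Sum>k<Suc m. indicator (stop k) \<omega> * ennreal (\<phi>' k \<omega>))"
    have "(\<integral>\<^sup>+\<omega>. Y (Suc m) \<omega> \<partial>P) = (\<integral>\<^sup>+\<omega>. ?Z \<omega> \<partial>P) + (\<integral>\<^sup>+\<omega>. indicator (late (Suc m)) \<omega> * ennreal (\<phi>' (Suc m) \<omega>) \<partial>P)"
      unfolding Y_def by (rule nn_integral_add) measurable
    also have "\<dots> \<le> (\<integral>\<^sup>+\<omega>. ?Z \<omega> \<partial>P) + (\<integral>\<^sup>+\<omega>. indicator (late (Suc m)) \<omega> * ennreal (\<phi>' m \<omega>) \<partial>P)"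
      by (intro add_left_mono induced_test_supermartingale[OF ind N m P late_Suc])
    also have "\<dots> = (\<integral>\<^sup>+\<omega>. ?Z \<omega> + indicator (late (Suc m)) \<omega> * ennreal (\<phi>' m \<omega>) \<partial>P)"
      by (rule nn_integral_add[symmetric]) measurable
    also have "\<dots> = (\<integral>\<^sup>+\<omega>. Y m \<omega> \<partial>P)"
      unfolding Y_def split[of m] by (intro nn_integral_cong) (simp add: distrib_right add.assoc)
    finally show ?thesis .
  qed
  have "(\<integral>\<^sup>+\<omega>. Y m \<omega> \<partial>P) \<le> (\<integral>\<^sup>+\<omega>. Y 0 \<omega> \<partial>P)" if "m \<le> N" for m
    using that by (induction m) (auto intro: order_trans[OF dec])
  then have "(\<integral>\<^sup>+\<omega>. Y N \<omega> \<partial>P) \<le> (\<integral>\<^sup>+\<omega>. Y 0 \<omega> \<partial>P)" by simp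
  also have "\<dots> = (\<integral>\<^sup>+\<omega>. ennreal (\<phi>' 0 \<omega>) \<partial>P)"
    by (intro nn_integral_cong) (simp add: Y_def late_def zero_enat_def[symmetric] spP)
  also have "\<dots> = emeasure (student_t (real N - 1)) {c<..}"
    by (rule induced_test_initial[OF ind N P(1-3)])
  also have "(\<integral>\<^sup>+\<omega>. Y N \<omega> \<partial>P) = (\<integral>\<^sup>+\<omega>. e2ennreal (stopped_test \<phi>' \<tau> \<omega>) \<partial>P)"
  proof (intro nn_integral_cong_AE)
    have "AE \<omega> in P. \<omega> \<in> space M" unfolding spP[symmetric] by (rule AE_space)
    then show "AE \<omega> in P. Y N \<omega> = e2ennreal (stopped_test \<phi>' \<tau> \<omega>)"
      using induced_test_final[OF ind N P(1-3)]
    proof eventually_elim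
      case (elim \<omega>)
      have ind_stop: "indicator (stop k) \<omega> = (if \<tau> \<omega> = enat k then 1 else 0 :: ennreal)" for k
        using elim(1) by (auto simp: stop_def)
      have ind_late: "indicator (late N) \<omega> = (if enat N \<le> \<tau> \<omega> then 1 else 0 :: ennreal)"
        using elim(1) by (auto simp: late_def)
      show ?case
      proof (cases "\<tau> \<omega>")
        case (enat n)
        have "(\<Sum>k<N. indicator (stop k) \<omega> * ennreal (\<phi>' k \<omega>)) = (\<Sum>k<N. if n = k then ennreal (\<phi>' k \<omega>) else 0)"
          unfolding ind_stop enat by (intro sum.cong) auto
        also have "\<dots> = (if n < N then ennreal (\<phi>' n \<omega>) else 0)"
          by simp
        finally show ?thesis
          using elim(2) unfolding Y_def ind_late enat by (auto simp: stopped_test_def enat ennreal_def)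
      next
        case infinity
        have "eventually (\<lambda>n. ereal (\<phi>' n \<omega>) = ereal (t_test X N c \<omega>)) sequentially"
          using elim(2) by (intro eventually_sequentiallyI[of N]) auto
        then have "limsup (\<lambda>n. ereal (\<phi>' n \<omega>)) = limsup (\<lambda>n. ereal (t_test X N c \<omega>))"
          by (rule Limsup_eq)
        then show ?thesis
          using elim(2) unfolding Y_def ind_late ind_stop infinity
          by (simp add: stopped_test_def infinity Limsup_const ennreal_def)
      qed
    qed
  qed
  finally show ?thesis .
qed

end

theorem proposition5:
  fixes M P0 :: "'a measure"
    and X :: "nat \<Rightarrow> 'a \<Rightarrow> real"
    and \<phi>' :: "nat \<Rightarrow> 'a \<Rightarrow> real"
    and \<alpha> c :: real
    and N :: nat
  assumes "0 < \<alpha>" and "\<alpha> < 1"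
    and "N > 1"
    and "sets P0 = sets M" and "iid_normal P0 X 0 1"
    and "is_upper_quantile (student_t (real N - 1)) \<alpha> c"
    and "induced_sequential_test P0 (t_filtration M X) (t_test X N c) \<phi>'"
  shows "anytime_valid (nonpos_mean_normal M X) (t_filtration M X) \<phi>' \<alpha>"
proof -
  interpret std_normal_model M P0 X
    by standard fact+
  have N: "2 \<le> N" using \<open>N > 1\<close> by simp
  have "emeasure (student_t (real N - 1)) {c<..} \<le> (\<integral>\<^sup>+\<omega>. 1 \<partial>P0)"
    unfolding t_test_level[OF N, symmetric]
    by (intro nn_integral_mono) (simp add: t_test_def indicator_def)
  also have "\<dots> < \<infinity>" by (simp add: P0.emeasure_space_1)
  finally have level: "emeasure (student_t (real N - 1)) {c<..} = ennreal \<alpha>"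
    using emeasure_eq_ennreal_measure[of "student_t (real N - 1)" "{c<..}"] assms(6)
    unfolding is_upper_quantile_def by simp
  show ?thesis
    unfolding anytime_valid_def
  proof (intro allI impI SUP_least)
    fix \<tau> P
    assume \<tau>: "stopping_time (t_filtration M X) \<tau>" and "P \<in> nonpos_mean_normal M X"
    then obtain \<mu> \<sigma> where P: "iid_normal P X \<mu> \<sigma>" "sets P = sets M" "0 < \<sigma>" "\<mu> \<le> 0"
      unfolding nonpos_mean_normal_def by blast
    show "(\<integral>\<^sup>+\<omega>. e2ennreal (stopped_test \<phi>' \<tau> \<omega>) \<partial>P) \<le> ennreal \<alpha>"
      using stopped_induced_test_le[OF assms(7) N P \<tau>] unfolding level .
  qed
qed

end
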